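(* We have $\mu(n)=f(n)(1+o(1))$ as $n\to\infty$, where $f(n)=\left\lceil \frac{1}{2}\left(\sqrt{4n-3}-1\right)\right\rceil$ and $\mu(n)$ is the $n$th mediation number.
   Context: Digraphs are finite, without loops or parallel arcs (both arcs $xy$ and $yx$ may be present). For a digraph $D$ and a vertex $x$, let $N^-(x)=\{y: yx\in A(D)\}$ and $N^-[x]=\{x\}\cup N^-(x)$; $\Delta^-(D)$ is the maximum of $|N^-(x)|$ over vertices $x$. A digraph $D$ is mediated if for every pair $x,y$ of distinct vertices there is a vertex $z$ (possibly $z=x$ or $z=y$) such that $x,y\in N^-[z]$. For $n\ge 1$, the $n$th mediation number $\mu(n)$ is the minimum of $\Delta^-(D)$ over all mediated digraphs $D$ on $n$ vertices. *)

theory Defs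
  imports Complex_Main "HOL-Library.Landau_Symbols" "Graph_Theory.Graph_Theory"
begin

text \<open>
  The locale \<^locale>\<open>pair_digraph\<close> describes finite digraphs without loops; as
  the arcs form a set of pairs of vertices, there are no parallel arcs, while opposite arcs are
  allowed. The arc \<open>(y, x)\<close> goes from \<open>y\<close> to \<open>x\<close>.
\<close>

definition in_nbhd :: "'a pair_pre_digraph \<Rightarrow> 'a \<Rightarrow> 'a set" where
  "in_nbhd D x = {y. (y, x) \<in> parcs D}"

definition closed_in_nbhd :: "'a pair_pre_digraph \<Rightarrow> 'a \<Rightarrow> 'a set" where
  "closed_in_nbhd D x = insert x (in_nbhd D x)"

definition max_in_degree :: "'a pair_pre_digraph \<Rightarrow> nat" where
  "max_in_degree D = Max ((\<lambda>x. card (in_nbhd D x)) ` pverts D)"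

definition mediated :: "'a pair_pre_digraph \<Rightarrow> bool" where
  "mediated D \<longleftrightarrow> pair_digraph D \<and>
     (\<forall>x \<in> pverts D. \<forall>y \<in> pverts D. x \<noteq> y \<longrightarrow>
        (\<exists>z \<in> pverts D. x \<in> closed_in_nbhd D z \<and> y \<in> closed_in_nbhd D z))"

text \<open>
  The vertices are taken to be natural numbers. As every finite digraph is isomorphic to one of
  this kind, this does not change the minimum; see \<open>mediation_number_le\<close> below. The value
  at \<open>n = 0\<close> is irrelevant.
\<close>

definition mediation_number :: "nat \<Rightarrow> nat" where
  "mediation_number n =
     (LEAST d. \<exists>D :: nat pair_pre_digraph.
        mediated D \<and> card (pverts D) = n \<and> max_in_degree D = d)"

lemma mediation_number_attained:
  obtains D :: "nat pair_pre_digraph"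
  where "mediated D" "card (pverts D) = n" "max_in_degree D = mediation_number n"
proof -
  define K :: "nat pair_pre_digraph"
    where "K = \<lparr> pverts = {..<n}, parcs = {(x, y). x < n \<and> y < n \<and> x \<noteq> y} \<rparr>"
  have "finite (parcs K)"
    by (rule finite_subset[of _ "{..<n} \<times> {..<n}"]) (auto simp: K_def)
  then have "pair_digraph K"
    by unfold_locales (auto simp: K_def)
  then have "mediated K"
    by (auto simp: mediated_def closed_in_nbhd_def in_nbhd_def K_def)
  then have "\<exists>d. \<exists>D :: nat pair_pre_digraph.
      mediated D \<and> card (pverts D) = n \<and> max_in_degree D = d"
    by (intro exI[of _ "max_in_degree K"] exI[of _ K]) (simp add: K_def)
  then have "\<exists>D :: nat pair_pre_digraph.
      mediated D \<and> card (pverts D) = n \<and> max_in_degree D = mediation_number n"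
    unfolding mediation_number_def by (rule LeastI_ex)
  then show thesis using that by blast
qed

lemma mediation_number_le:
  fixes D :: "'a pair_pre_digraph"
  assumes "mediated D"
  shows "mediation_number (card (pverts D)) \<le> max_in_degree D"
proof -
  interpret pair_digraph D using assms by (simp add: mediated_def)
  obtain f :: "'a \<Rightarrow> nat" where inj: "inj_on f (pverts D)"
    using finite_imp_inj_to_nat_seg[OF pair_finite_verts] by blast
  define E :: "nat pair_pre_digraph"
    where "E = \<lparr> pverts = f ` pverts D, parcs = map_prod f f ` parcs D \<rparr>"
  have E: "pair_digraph E"
  proof
    show "fst e \<noteq> snd e" if e: "e \<in> parcs E" for e
    proof -
      obtain u v where uv: "(u, v) \<in> parcs D" "e = (f u, f v)"
        using e by (auto simp: E_def)
      then have "u \<noteq> v" "u \<in> pverts D" "v \<in> pverts D"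
        using pair_no_loops wellformed' by fastforce+
      then show ?thesis using inj uv by (auto dest: inj_onD)
    qed
  qed (use pair_finite_verts pair_finite_arcs wellformed' in \<open>auto simp: E_def\<close>)
  have nb: "in_nbhd E (f x) = f ` in_nbhd D x" if "x \<in> pverts D" for x
    using that inj wellformed' by (fastforce simp: E_def in_nbhd_def dest: inj_onD)
  have "card (in_nbhd E (f x)) = card (in_nbhd D x)" if "x \<in> pverts D" for x
    unfolding nb[OF that]
    by (rule card_image, rule inj_on_subset[OF inj]) (auto simp: in_nbhd_def dest: wellformed')
  then have deg: "max_in_degree E = max_in_degree D"
    by (simp add: max_in_degree_def E_def image_image cong: image_cong_simp)
  have "mediated E"
    unfolding mediated_def
  proof (intro conjI ballI impI)
    fix a b assume "a \<in> pverts E" "b \<in> pverts E" "a \<noteq> b"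
    then obtain x y where xy: "x \<in> pverts D" "y \<in> pverts D" "x \<noteq> y" "a = f x" "b = f y"
      by (auto simp: E_def)
    then obtain z where z: "z \<in> pverts D" "x \<in> closed_in_nbhd D z" "y \<in> closed_in_nbhd D z"
      using assms unfolding mediated_def by blast
    then show "\<exists>z \<in> pverts E. a \<in> closed_in_nbhd E z \<and> b \<in> closed_in_nbhd E z"
      using xy by (intro bexI[of _ "f z"]) (auto simp: closed_in_nbhd_def nb, auto simp: E_def)
  qed (fact E)
  moreover have "card (pverts E) = card (pverts D)"
    by (simp add: E_def card_image[OF inj])
  ultimately show ?thesis
    unfolding mediation_number_def using deg by (intro Least_le) blast
qed

definition f_bound :: "nat \<Rightarrow> int" where
  "f_bound n = \<lceil>(sqrt (4 * real n - 3) - 1) / 2\<rceil>"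

end

theory Submission
  imports Defs "HOL-Complex_Analysis.Complex_Analysis" "HOL-Number_Theory.Number_Theory" "HOL-Real_Asymp.Real_Asymp"
begin

text \<open>
  Counting the pairs mediated by each vertex gives \<open>n - 1 \<le> d (d + 1)\<close> for the maximum in-degree \<open>d\<close>, which
  is the lower bound \<open>f n \<le> \<mu> n\<close>. For the upper bound take a prime \<open>q\<close> slightly below \<open>sqrt n\<close>, let the points
  of the affine plane over the field with \<open>q\<close> elements mediate its lines, and add the remaining \<open>o(n)\<close>
  vertices as twins of points that are spread so evenly that every line gains only \<open>o(sqrt n)\<close> vertices.

  Such a prime exists because consecutive primes have ratio tending to 1. This is obtained by Newman's
  method: \<open>\<Sum> (\<psi> n - n) / n powr (s + 1)\<close> extends analytically across \<open>Re s = 1\<close>, since \<open>\<zeta>\<close> has no zeros there,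
  and \<open>\<psi> n = O(n)\<close>; hence \<open>\<Sum> (\<psi> n - n) / n\<^sup>2\<close> converges, which rules out long intervals on which \<open>\<psi>\<close> is
  nearly constant.
\<close>

section \<open>Newman's Tauberian theorem for Dirichlet series\<close>

text \<open>Bertrand's postulate would lose a constant factor in the degree, so the ratio of
  consecutive primes is what matters. The prime has to lie below \<open>sqrt n\<close>: a vertex is
  both a point and the mediator of a line, so deleting vertices from too large a plane would leave
  pairs without a mediator, whereas a twin merely enlarges the lines through its point. The twins
  are laid out \<open>q\<close> at a time along translates of the parabola y = x^2, because a
  non-vertical line meets such a parabola at most twice and a vertical line once; \<open>t\<close>
  translates cost at most \<open>2 * t\<close> in degree. The passage to the left of Re s = 1 rests
  on Abel summation with a second-order error, used for \<open>zeta\<close> and for the series in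
  \<open>psi\<close> alike.\<close>

lemma powr_diff_mean_value:
  fixes a y :: real
  assumes "a > 0"
  obtains \<xi> where "a < \<xi>" "\<xi> < a + 1" "(a + 1) powr y - a powr y = y * \<xi> powr (y - 1)"
proof -
  have "\<exists>z>a. z < a + 1 \<and> (a + 1) powr y - a powr y = (a + 1 - a) * (y * z powr (y - 1))"
    using assms by (intro MVT2) (auto intro!: derivative_eq_intros)
  then show thesis using that by auto
qed

text \<open>Comparison with the integral of x^(y - 1). If y >= 1 the terms increase, and the extra
  summand \<open>real N powr (y - 1)\<close> pays for the last of them.\<close>

lemma sum_powr_le:
  fixes y :: real
  assumes "y > 0"
  shows "(\<Sum>n<N. real (Suc n) powr (y - 1)) \<le> real N powr (y - 1) + real N powr y / y"
proof (cases "y \<ge> 1")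
  case True
  have *: "(\<Sum>n<M. real (Suc n) powr (y - 1)) \<le> real (Suc M) powr y / y" for M
  proof (induction M)
    case (Suc M)
    obtain \<xi> where \<xi>: "real (Suc M) < \<xi>" "\<xi> < real (Suc M) + 1"
      "(real (Suc M) + 1) powr y - real (Suc M) powr y = y * \<xi> powr (y - 1)"
      using powr_diff_mean_value[of "real (Suc M)" y] by auto
    have "real (Suc M) powr (y - 1) \<le> \<xi> powr (y - 1)"
      using \<xi> True by (intro powr_mono2) auto
    also have "\<dots> = ((real (Suc M) + 1) powr y - real (Suc M) powr y) / y"
      using \<xi>(3) assms by simp
    finally show ?case using Suc assms by (simp add: diff_divide_distrib add.commute)
  qed (use assms in auto)
  show ?thesis
  proof (cases N)
    case (Suc M)
    then show ?thesis using *[of M] by simp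
  qed (use assms in auto)
next
  case False
  have "(\<Sum>n<N. real (Suc n) powr (y - 1)) \<le> real N powr y / y"
  proof (induction N)
    case (Suc M)
    show ?case
    proof (cases "M = 0")
      case True
      then show ?thesis using assms False by simp
    next
      case False
      then obtain \<xi> where \<xi>: "real M < \<xi>" "\<xi> < real M + 1"
        "(real M + 1) powr y - real M powr y = y * \<xi> powr (y - 1)"
        using powr_diff_mean_value[of "real M" y] by auto
      have "real (Suc M) powr (y - 1) \<le> \<xi> powr (y - 1)"
        using \<xi> \<open>\<not> y \<ge> 1\<close> by (intro powr_mono2') auto
      also have "\<dots> = ((real M + 1) powr y - real M powr y) / y"
        using \<xi>(3) assms by simp
      finally show ?thesis using Suc assms by (simp add: diff_divide_distrib add.commute)
    qed
  qed (use assms in auto)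
  then show ?thesis by (smt (verit) powr_ge_zero)
qed

lemma sums_powr_telescope:
  fixes x :: real
  assumes "x > 0"
  shows "(\<lambda>n. real (n + N) powr (-x) - real (Suc (n + N)) powr (-x)) sums (real N powr (-x))"
proof -
  have "(\<lambda>n. real (n + N) powr (-x)) \<longlonglongrightarrow> 0"
    using assms by real_asymp
  from telescope_sums'[OF this] show ?thesis by simp
qed

text \<open>The mean value theorem dominates each term by a difference that telescopes in
  \<open>sums_powr_telescope\<close>.\<close>

lemma powr_tail_term_le:
  fixes x :: real
  assumes "x > 0" "a > 0"
  shows "(a + 1) powr (-x - 1) \<le> (a powr (-x) - (a + 1) powr (-x)) / x"
proof -
  obtain \<xi> where \<xi>: "a < \<xi>" "\<xi> < a + 1" "(a + 1) powr (-x) - a powr (-x) = (-x) * \<xi> powr (-x - 1)"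
    using powr_diff_mean_value[of a "-x"] assms by auto
  have "(a + 1) powr (-x - 1) \<le> \<xi> powr (-x - 1)"
    using \<xi> assms by (intro powr_mono2') auto
  also have "\<dots> = (a powr (-x) - (a + 1) powr (-x)) / x"
    using \<xi>(3) assms by (simp add: field_simps)
  finally show ?thesis .
qed

lemma norm_of_nat_powr [simp]: "n > 0 \<Longrightarrow> norm (of_nat n powr z :: complex) = real n powr Re z"
  by (subst norm_powr_real_powr) auto

text \<open>The tail begins with base N + 1, so comparison with the integral from N costs no
  boundary term. What matters is the explicit 1 / Re z, which Newman's kernel will cancel.\<close>

lemma norm_dirichlet_tail_le:
  fixes c :: "nat \<Rightarrow> complex"
  assumes c: "\<And>n. norm (c n) \<le> C / real (Suc n)" and z: "Re z > 0" and N: "N > 0"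
    and sums: "(\<lambda>n. c n * of_nat (Suc n) powr (-z)) sums G"
  shows "norm (G - (\<Sum>n<N. c n * of_nat (Suc n) powr (-z))) \<le> C * real N powr (- Re z) / Re z"
proof -
  let ?t = "\<lambda>n. C * ((real (n + N) powr (- Re z) - real (Suc (n + N)) powr (- Re z)) / Re z)"
  have C: "C \<ge> 0" using order_trans[OF norm_ge_zero c[of 0]] by simp
  have t: "?t sums (C * (real N powr (- Re z) / Re z))"
    by (intro sums_mult sums_divide sums_powr_telescope z)
  have "(\<lambda>n. c (n + N) * of_nat (Suc (n + N)) powr (-z)) sums
      (G - (\<Sum>n<N. c n * of_nat (Suc n) powr (-z)))"
    using sums_split_initial_segment[OF sums] .
  moreover have "norm (c (n + N) * of_nat (Suc (n + N)) powr (-z)) \<le> ?t n" for n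
  proof -
    have "norm (c (n + N) * of_nat (Suc (n + N)) powr (-z)) \<le>
        C / real (Suc (n + N)) * real (Suc (n + N)) powr (- Re z)"
      unfolding norm_mult
      using mult_right_mono[OF c powr_ge_zero] by (simp add: norm_of_nat_powr[OF zero_less_Suc] del: of_nat_Suc)
    also have "\<dots> = C * (real (n + N) + 1) powr (- Re z - 1)"
      by (simp add: powr_diff add.commute)
    also have "\<dots> \<le> ?t n"
      using powr_tail_term_le[OF z, of "real (n + N)"] N C
      by (intro mult_left_mono) (auto simp: add.commute)
    finally show ?thesis .
  qed
  ultimately show ?thesis
    using t by (metis (no_types, lifting) norm_suminf_le sums_iff times_divide_eq_right)
qed

text \<open>Counterpart of the tail bound in the left half plane, where the partial sums grow. The
  boundary term is smaller by a factor of order 1 / N and disappears in the limit.\<close>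

lemma norm_dirichlet_partial_le:
  fixes c :: "nat \<Rightarrow> complex"
  assumes c: "\<And>n. norm (c n) \<le> C / real (Suc n)" and z: "Re z < 0"
  shows "norm (\<Sum>n<N. c n * of_nat (Suc n) powr (-z))
    \<le> C * (real N powr (- Re z - 1) + real N powr (- Re z) / (- Re z))"
proof -
  have C: "C \<ge> 0" using order_trans[OF norm_ge_zero c[of 0]] by simp
  have "norm (\<Sum>n<N. c n * of_nat (Suc n) powr (-z))
      \<le> (\<Sum>n<N. C * real (Suc n) powr (- Re z - 1))"
  proof (rule sum_norm_le)
    fix n
    have "norm (c n * of_nat (Suc n) powr (-z)) \<le> C / real (Suc n) * real (Suc n) powr (- Re z)"
      unfolding norm_mult
      using mult_right_mono[OF c powr_ge_zero] by (simp add: norm_of_nat_powr[OF zero_less_Suc] del: of_nat_Suc)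
    also have "\<dots> = C * real (Suc n) powr (- Re z - 1)" by (simp add: powr_diff)
    finally show "norm (c n * of_nat (Suc n) powr (-z)) \<le> \<dots>" .
  qed
  also have "\<dots> \<le> C * (real N powr (- Re z - 1) + real N powr (- Re z) / (- Re z))"
    unfolding sum_distrib_left[symmetric] using C z by (intro mult_left_mono sum_powr_le) auto
  finally show ?thesis .
qed

section \<open>Cauchy's formula on a contour made of a half circle and a left path\<close>

lemma Ln_of_real_times_ii:
  assumes "R > 0"
  shows "Ln (of_real R * \<i>) = of_real (ln R) + \<i> * pi / 2"
    and "Ln (- (of_real R * \<i>)) = of_real (ln R) - \<i> * pi / 2"
  using Ln_times_of_real[OF assms, of "\<i>"] Ln_times_of_real[OF assms, of "-\<i>"] assms
  by (auto simp: Ln_of_real)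

text \<open>The right arc avoids the branch cut of \<open>Ln\<close>, which is therefore a primitive
  of \<open>inverse\<close> along it.\<close>

lemma has_contour_integral_inverse_right_arc:
  assumes "R > 0"
  shows "(inverse has_contour_integral \<i> * pi) (part_circlepath 0 R (-pi/2) (pi/2))"
    and "path_image (part_circlepath 0 R (-pi/2) (pi/2)) \<subseteq> {z. norm z = R \<and> Re z \<ge> 0}"
proof -
  let ?A = "part_circlepath 0 R (-pi/2) (pi/2)"
  show *: "path_image ?A \<subseteq> {z. norm z = R \<and> Re z \<ge> 0}"
    using assms by (auto simp: path_image_part_circlepath norm_mult Re_exp intro!: mult_nonneg_nonneg cos_ge_zero)
  have "(inverse has_contour_integral (Ln (pathfinish ?A) - Ln (pathstart ?A))) ?A"
  proof (rule contour_integral_primitive)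
    fix z :: complex assume z: "z \<in> - \<real>\<^sub>\<le>\<^sub>0"
    then show "(Ln has_field_derivative inverse z) (at z within - \<real>\<^sub>\<le>\<^sub>0)"
      by (auto intro!: derivative_eq_intros)
  next
    show "path_image ?A \<subseteq> - \<real>\<^sub>\<le>\<^sub>0"
      using * assms by (fastforce simp: complex_nonpos_Reals_iff norm_complex_def)
  qed auto
  moreover have "pathfinish ?A = of_real R * \<i>" "pathstart ?A = - (of_real R * \<i>)"
    by (auto simp: exp_eq_polar cis_pi_half intro!: complex_eqI)
  ultimately show "(inverse has_contour_integral \<i> * pi) ?A"
    using assms by (simp add: Ln_of_real_times_ii)
qed

text \<open>Away from the nonnegative reals \<open>Ln (-z)\<close> is a primitive of 1 / z, so the
  value depends on the end points only.\<close>

lemma has_contour_integral_inverse_left: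
  assumes "R > 0" and g: "valid_path g" "pathstart g = \<i> * of_real R" "pathfinish g = - \<i> * of_real R"
    and sub: "path_image g \<subseteq> - \<real>\<^sub>\<ge>\<^sub>0"
  shows "(inverse has_contour_integral \<i> * pi) g"
proof -
  have "(inverse has_contour_integral (Ln (- pathfinish g) - Ln (- pathstart g))) g"
  proof (rule contour_integral_primitive[OF _ g(1) sub, of "\<lambda>z. Ln (-z)"])
    fix z :: complex assume z: "z \<in> - \<real>\<^sub>\<ge>\<^sub>0"
    then have "-z \<notin> \<real>\<^sub>\<le>\<^sub>0" by (auto simp: complex_nonpos_Reals_iff complex_nonneg_Reals_iff)
    moreover have "z \<noteq> 0" using z by auto
    ultimately show "((\<lambda>z. Ln (-z)) has_field_derivative inverse z) (at z within - \<real>\<^sub>\<ge>\<^sub>0)"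
      by (auto intro!: derivative_eq_intros simp: field_simps)
  qed
  moreover have "- pathfinish g = of_real R * \<i>" "- pathstart g = - (of_real R * \<i>)"
    using g by auto
  ultimately show ?thesis
    using assms(1) by (simp only: Ln_of_real_times_ii) simp
qed

text \<open>Each of the two pieces contributes half a turn around 0, which makes the winding number
  1. The left path is arbitrary because two are used: a polygon close to the imaginary axis for
  \<open>G\<close>, and the left half circle for the partial sums.\<close>

lemma Cauchy_integral_formula_half_circle:
  fixes f :: "complex \<Rightarrow> complex"
  assumes R: "R > 0" and g: "valid_path g" "pathstart g = \<i> * of_real R" "pathfinish g = - \<i> * of_real R"
    and sub: "path_image g \<subseteq> - \<real>\<^sub>\<ge>\<^sub>0" "path_image g \<subseteq> V"
    and V: "open V" "convex V" "{z. norm z \<le> R \<and> Re z \<ge> 0} \<subseteq> V"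
    and f: "f holomorphic_on V"
  shows "contour_integral (part_circlepath 0 R (-pi/2) (pi/2)) (\<lambda>z. f z / z) +
         contour_integral g (\<lambda>z. f z / z) = 2 * pi * \<i> * f 0"
proof -
  let ?A = "part_circlepath 0 R (-pi/2) (pi/2)"
  note A = has_contour_integral_inverse_right_arc[OF R]
  have pA: "pathfinish ?A = \<i> * of_real R" "pathstart ?A = - \<i> * of_real R"
    by (auto simp: exp_eq_polar cis_pi_half intro!: complex_eqI)
  have vA: "valid_path ?A" and AV: "path_image ?A \<subseteq> V - {0}"
    using A(2) V R by auto
  have gV: "path_image g \<subseteq> V - {0}"
    using sub by auto
  have 0: "0 \<in> V" using V R by (auto simp: subset_iff)
  have "((\<lambda>z. 1 / (z - 0)) has_contour_integral \<i> * pi + \<i> * pi) (?A +++ g)"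
    using has_contour_integral_join[OF A(1) has_contour_integral_inverse_left[OF R g sub(1)] vA g(1)]
    by (simp add: inverse_eq_divide[abs_def])
  moreover have "0 \<notin> path_image (?A +++ g)"
    using AV gV pA g by (auto simp: path_image_join)
  moreover have valid: "valid_path (?A +++ g)"
    using vA g pA by (intro valid_path_join) auto
  ultimately have wn: "winding_number (?A +++ g) 0 = 1"
    using winding_number_valid_path[of "?A +++ g" 0] contour_integral_unique by fastforce
  have "((\<lambda>z. f z / (z - 0)) has_contour_integral 2 * pi * \<i> * winding_number (?A +++ g) 0 * f 0) (?A +++ g)"
    using V f 0 valid AV gV pA g
    by (intro Cauchy_integral_formula_convex_simple[where S = V])
       (auto simp: interior_open path_image_join)
  then have 1: "((\<lambda>z. f z / z) has_contour_integral 2 * pi * \<i> * f 0) (?A +++ g)"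
    unfolding wn by simp
  have cont: "continuous_on (V - {0}) (\<lambda>z. f z / z)"
    using f by (intro continuous_intros holomorphic_on_imp_continuous_on) (auto elim: holomorphic_on_subset)
  have "(\<lambda>z. f z / z) holomorphic_on V - {0}"
    using f by (intro holomorphic_intros) (auto elim: holomorphic_on_subset)
  then have "(\<lambda>z. f z / z) contour_integrable_on ?A" "(\<lambda>z. f z / z) contour_integrable_on g"
    using vA g AV gV V by (auto intro!: contour_integrable_holomorphic_simple[where S = "V - {0}"])
  then show ?thesis
    using contour_integral_unique[OF 1] vA g pA by simp
qed

text \<open>Dominated convergence: |N powr z| is at most 1 and tends to 0 wherever Re z < 0. The
  integral is taken over the open interval since Re z may vanish at the end points.\<close>

lemma tendsto_contour_integral_linepath_left:
  fixes f :: "complex \<Rightarrow> complex"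
  assumes f: "continuous_on (closed_segment a b) f"
    and neg: "\<And>z. z \<in> open_segment a b \<Longrightarrow> Re z < 0" and le: "Re a \<le> 0" "Re b \<le> 0"
    and "a \<noteq> b"
  shows "(\<lambda>N. contour_integral (linepath a b) (\<lambda>z. f z * of_nat (Suc N) powr z)) \<longlonglongrightarrow> 0"
proof -
  let ?F = "\<lambda>N t. f (linepath a b t) * of_nat (Suc N) powr (linepath a b t) * (b - a)"
  let ?I = "{0<..<1::real}"
  have cont: "continuous_on {0..1} (?F N)" for N
  proof -
    have "continuous_on {0..1} (\<lambda>t. f (linepath a b t))"
      using f by (rule continuous_on_compose2) (auto simp: linepath_in_path)
    then show ?thesis by (intro continuous_intros) (auto simp del: of_nat_Suc)
  qed
  obtain B where B: "\<And>z. z \<in> closed_segment a b \<Longrightarrow> norm (f z) \<le> B"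
    using compact_imp_bounded[OF compact_continuous_image[OF f compact_segment]]
    by (auto simp: bounded_iff)
  have bd: "norm (?F N t) \<le> B * norm (b - a)" and seg: "linepath a b t \<in> open_segment a b"
    if t: "t \<in> ?I" for N t
  proof -
    show s: "linepath a b t \<in> open_segment a b"
      using t \<open>a \<noteq> b\<close> by (auto simp: in_segment linepath_def)
    have "norm (f (linepath a b t)) \<le> B"
      using B[of "linepath a b t"] s open_closed_segment by blast
    moreover have "norm (of_nat (Suc N) powr (linepath a b t) :: complex) \<le> 1"
      using neg[OF s] powr_mono[of "Re (linepath a b t)" 0 "real (Suc N)"] by (subst norm_powr_real_powr) auto
    ultimately show "norm (?F N t) \<le> B * norm (b - a)"
      unfolding norm_mult
      by (metis mult_mono' mult.right_neutral mult_right_mono norm_ge_zero)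
  qed
  have "(\<lambda>N. integral ?I (?F N)) \<longlonglongrightarrow> integral ?I (\<lambda>_. 0 :: complex)"
  proof (rule dominated_convergence(2))
    show "?F N integrable_on ?I" for N
      using integrable_continuous_real[OF cont[of N]] by (simp add: integrable_on_Icc_iff_Ioo)
    show "(\<lambda>_. B * norm (b - a)) integrable_on ?I"
      unfolding integrable_on_Icc_iff_Ioo[symmetric] by (rule integrable_const_ivl)
    fix t :: real assume t: "t \<in> ?I"
    have "Re (linepath a b t) < 0" using neg seg[OF t] by blast
    then have "(\<lambda>N. real (Suc N) powr Re (linepath a b t)) \<longlonglongrightarrow> 0" by real_asymp
    then have "(\<lambda>N. norm (of_nat (Suc N) powr (linepath a b t) :: complex)) \<longlonglongrightarrow> 0"
      by (subst norm_powr_real_powr) auto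
    then have "(\<lambda>N. of_nat (Suc N) powr (linepath a b t) :: complex) \<longlonglongrightarrow> 0"
      by (rule tendsto_norm_zero_cancel)
    from tendsto_mult[OF tendsto_mult[OF tendsto_const this] tendsto_const]
    show "(\<lambda>N. ?F N t) \<longlonglongrightarrow> 0" by simp
  qed (use bd in auto)
  moreover have "contour_integral (linepath a b) (\<lambda>z. f z * of_nat (Suc N) powr z) = integral ?I (?F N)" for N
    by (simp add: contour_integral_integral integral_open_interval_real)
  ultimately show ?thesis by simp
qed

text \<open>On the circle R^2 equals \<open>z * cnj z\<close>, which turns the kernel into the real
  number \<open>(z + cnj z) / R\<^sup>2\<close>.\<close>

lemma norm_newman_kernel:
  assumes "norm z = R" "R > 0"
  shows "norm ((1 + z\<^sup>2 / of_real (R\<^sup>2)) / z) = 2 * \<bar>Re z\<bar> / R\<^sup>2"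
proof -
  have "z \<noteq> 0" using assms by auto
  have "of_real (R\<^sup>2) = z * cnj z"
    using assms complex_norm_square[of z] by simp
  then have "(1 + z\<^sup>2 / of_real (R\<^sup>2)) / z = (z + cnj z) / of_real (R\<^sup>2)"
    using \<open>z \<noteq> 0\<close> by (simp add: field_simps power2_eq_square)
  also have "\<dots> = of_real (2 * Re z / R\<^sup>2)"
    by (simp add: complex_add_cnj)
  finally show ?thesis by (simp only: norm_of_real) (simp add: abs_mult)
qed

text \<open>
  Newman's contour argument: \<open>(G - S N) z * N powr z * (1 + z\<^sup>2 / R\<^sup>2) / z\<close> is integrated over a half circle of
  radius \<open>R\<close> closed up in the left half plane. On \<open>norm z = R\<close> the kernel is \<open>2 Re z / R\<^sup>2\<close>, which cancels the
  factor \<open>1 / Re z\<close> in the bounds for the tail and for the partial sums. The contribution of \<open>S N\<close>, which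
  is entire, is moved to the left half of the full circle.
\<close>

theorem newman_dirichlet_series:
  fixes c :: "nat \<Rightarrow> complex"
  assumes c: "\<And>n. norm (c n) \<le> C / real (Suc n)"
    and U: "open U" "{z. Re z \<ge> 0} \<subseteq> U" and G: "G holomorphic_on U"
    and sums: "\<And>z. Re z > 0 \<Longrightarrow> (\<lambda>n. c n * of_nat (Suc n) powr (-z)) sums G z"
  shows "c sums G 0"
proof -
  have C: "C \<ge> 0" using order_trans[OF norm_ge_zero c[of 0]] by simp
  define S where "S = (\<lambda>N z. \<Sum>n<N. c n * of_nat (Suc n) powr (-z))"
  have holS: "S N holomorphic_on X" for N X
    unfolding S_def by (intro holomorphic_intros) (auto simp del: of_nat_Suc)
  have key: "\<forall>\<^sub>F N in sequentially. norm (G 0 - S (Suc N) 0) < e" if e: "e > 0" for e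
  proof -
    \<comment> \<open>After division by 2 pi each half circle contributes C / R, up to a term
      vanishing with N; this choice puts the sum of both below e / 2. The summand 1 keeps R positive
      when C = 0.\<close>
    define R where "R = 4 * C / e + 1"
    have R: "R > 0" "2 * C / R < e / 2"
      using C e by (auto simp: R_def field_simps add_pos_nonneg)
    define k where "k = (\<lambda>z. 1 + z\<^sup>2 / complex_of_real (R\<^sup>2))"
    have holk: "k holomorphic_on X" for X
      unfolding k_def using R by (intro holomorphic_intros) auto
    have k0: "k 0 = 1" by (simp add: k_def)
    \<comment> \<open>\<open>G\<close> is holomorphic beyond the imaginary axis by an amount that
      may shrink with the height. Compactness gives a uniform width d, and the half-strip V is
      convex, as the version of Cauchy's formula above demands.\<close>
    let ?K = "{z. Re z = 0 \<and> \<bar>Im z\<bar> \<le> R + 1}"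
    have "compact ?K"
    proof -
      have "?K = cbox (Complex 0 (-R-1)) (Complex 0 (R+1))"
        by (auto simp: in_cbox_complex_iff)
      then show ?thesis by simp
    qed
    moreover have "?K \<subseteq> U" using U by auto
    ultimately obtain d where d: "d > 0" "(\<Union>x\<in>?K. ball x d) \<subseteq> U"
      using U(1) compact_subset_open_imp_ball_epsilon_subset[of ?K U] by metis
    define V where "V = {z. Re z > - d} \<inter> ({z. Im z < R + 1} \<inter> {z. Im z > - (R + 1)})"
    have V: "open V" "convex V"
      unfolding V_def
      by (intro open_Int convex_Int open_halfspace_Re_gt open_halfspace_Im_lt open_halfspace_Im_gt
          convex_halfspace_Re_gt convex_halfspace_Im_lt convex_halfspace_Im_gt)+
    have "V \<subseteq> U"
    proof
      fix z assume z: "z \<in> V"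
      show "z \<in> U"
      proof (cases "Re z \<ge> 0")
        case False
        then have "z \<in> ball (Complex 0 (Im z)) d"
          using z by (auto simp: V_def dist_norm norm_complex_def)
        then show ?thesis using d z by (auto simp: V_def intro!: subsetD[OF d(2)] UN_I[of "Complex 0 (Im z)"])
      qed (use U in auto)
    qed
    then have holG: "G holomorphic_on V" using G holomorphic_on_subset by blast
    have half: "{z. norm z \<le> R \<and> Re z \<ge> 0} \<subseteq> V"
    proof
      fix z assume "z \<in> {z. norm z \<le> R \<and> Re z \<ge> 0}"
      then show "z \<in> V" using d(1) abs_Im_le_cmod[of z] unfolding V_def by auto
    qed

    let ?A = "part_circlepath 0 R (-pi/2) (pi/2)" and ?A' = "part_circlepath 0 R (pi/2) (3*pi/2)"
    \<comment> \<open>The polygon through -d/2 touches the imaginary axis only at its end points, so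
      the factor \<open>of_nat (Suc N) powr z\<close> tends to 0 at every other point of it.\<close>
    let ?a = "\<i> * complex_of_real R" and ?b = "- complex_of_real (d / 2)"
    let ?g = "linepath ?a ?b +++ linepath ?b (- ?a)"
    note A = has_contour_integral_inverse_right_arc(2)[OF R(1)]
    have A': "path_image ?A' \<subseteq> {z. norm z = R \<and> Re z \<le> 0}"
    proof -
      have "cos x \<le> 0" if "pi / 2 \<le> x" "x \<le> 3 * pi / 2" for x
        using cos_ge_zero[of "x - pi"] that by simp
      then show ?thesis
        using R by (auto simp: path_image_part_circlepath norm_mult Re_exp mult_nonneg_nonpos)
    qed
    have seg1: "Re z < 0 \<or> z = ?a" if "z \<in> closed_segment ?a ?b" for z
    proof -
      obtain u where "0 \<le> u" "z = (1 - u) *\<^sub>R ?a + u *\<^sub>R ?b"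
        using \<open>z \<in> closed_segment ?a ?b\<close> by (auto simp: in_segment)
      then show ?thesis using d(1) by (cases "u = 0") auto
    qed
    have seg2: "Re z < 0 \<or> z = - ?a" if "z \<in> closed_segment ?b (- ?a)" for z
    proof -
      obtain u where "u \<le> 1" "z = (1 - u) *\<^sub>R ?b + u *\<^sub>R (- ?a)"
        using \<open>z \<in> closed_segment ?b (- ?a)\<close> by (auto simp: in_segment)
      then show ?thesis using d(1) by (cases "u = 1") auto
    qed
    have segV: "closed_segment ?a ?b \<subseteq> V" "closed_segment ?b (- ?a) \<subseteq> V"
      using V(2) R d by (intro closed_segment_subset; auto simp: V_def)+
    have g: "path_image ?g \<subseteq> - \<real>\<^sub>\<ge>\<^sub>0" "path_image ?g \<subseteq> V"
    proof -
      have "z \<notin> \<real>\<^sub>\<ge>\<^sub>0" if "Re z < 0 \<or> z = ?a \<or> z = - ?a" for z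
        using that R(1) by (auto simp: complex_nonneg_Reals_iff)
      then have "closed_segment ?a ?b \<subseteq> - \<real>\<^sub>\<ge>\<^sub>0" "closed_segment ?b (- ?a) \<subseteq> - \<real>\<^sub>\<ge>\<^sub>0"
        using seg1 seg2 by blast+
      then show "path_image ?g \<subseteq> - \<real>\<^sub>\<ge>\<^sub>0" "path_image ?g \<subseteq> V"
        using segV by (simp_all add: path_image_join)
    qed
    define F where "F = (\<lambda>N z. G z * k z / z * of_nat (Suc N) powr z)"
    define T where "T = (\<lambda>N z. S (Suc N) z * k z / z * of_nat (Suc N) powr z)"
    have F: "contour_integral ?A (F N) + contour_integral ?g (F N) = 2 * pi * \<i> * G 0" for N
    proof -
      have "(\<lambda>z. G z * k z * of_nat (Suc N) powr z) holomorphic_on V"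
        by (intro holomorphic_intros holG holk) (simp del: of_nat_Suc)
      from Cauchy_integral_formula_half_circle[OF R(1) _ _ _ g V half this]
      show ?thesis by (simp add: F_def k0 valid_path_join del: of_nat_Suc)
    qed
    have T: "contour_integral ?A (T N) + contour_integral ?A' (T N) = 2 * pi * \<i> * S (Suc N) 0" for N
    proof -
      have 1: "path_image ?A' \<subseteq> - \<real>\<^sub>\<ge>\<^sub>0"
        using A' R by (fastforce simp: complex_nonneg_Reals_iff norm_complex_def)
      have 2: "pathstart ?A' = ?a"
        by (auto simp: exp_eq_polar cis_pi_half)
      have 3: "pathfinish ?A' = - \<i> * complex_of_real R"
      proof -
        have "cis (3 * pi / 2) = cis (pi + pi / 2)" by (simp add: field_simps)
        also have "\<dots> = - \<i>" by (subst cis_mult[symmetric]) (simp add: cis_pi_half)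
        finally show ?thesis by (simp add: exp_eq_polar)
      qed
      have "(\<lambda>z. S (Suc N) z * k z * of_nat (Suc N) powr z) holomorphic_on UNIV"
        by (intro holomorphic_intros holS holk) (simp del: of_nat_Suc)
      from Cauchy_integral_formula_half_circle[OF R(1) valid_path_part_circlepath 2 3 1 subset_UNIV open_UNIV convex_UNIV subset_UNIV this]
      show ?thesis by (simp add: T_def k0 del: of_nat_Suc)
    qed
    have AV: "path_image ?A \<subseteq> V - {0}" using A half R by auto
    have intF: "F N contour_integrable_on ?A" for N
    proof (rule contour_integrable_holomorphic_simple)
      show "F N holomorphic_on V - {0}"
        unfolding F_def using holG by (intro holomorphic_intros holk) (auto elim: holomorphic_on_subset simp del: of_nat_Suc)
    qed (use V AV in auto)
    have intT: "T N contour_integrable_on p" if "valid_path p" "0 \<notin> path_image p" for N p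
    proof (rule contour_integrable_holomorphic_simple)
      show "T N holomorphic_on UNIV - {0}"
        unfolding T_def by (intro holomorphic_intros holk holS) (auto simp del: of_nat_Suc)
    qed (use that in auto)
    \<comment> \<open>At these two points the bounds for the tail and for the partial sums would
      divide by Re z = 0; an integrand bound off a finite set is enough for the arcs.\<close>
    have endpts: "z \<in> {?a, - ?a}" if "norm z = R" "Re z = 0" for z
      using that R by (auto simp: norm_complex_def complex_eq_iff)

    have bA: "norm (contour_integral ?A (\<lambda>z. F N z - T N z)) \<le> 2 * C / R\<^sup>2 * R * (pi / 2 - (-pi / 2))" for N
    proof (rule contour_integral_bound_part_circlepath_strong[where k = "{?a, - ?a}"])
      show "(\<lambda>z. F N z - T N z) contour_integrable_on ?A"
        using AV by (intro contour_integrable_diff intF intT) auto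
      fix z assume z: "z \<in> path_image ?A - {?a, - ?a}"
      then have z: "norm z = R" "Re z > 0" using A endpts[of z] by force+
      have "norm (F N z - T N z) = norm (G z - S (Suc N) z) * norm (k z / z) * real (Suc N) powr Re z"
        unfolding F_def T_def
        by (simp add: norm_mult[symmetric] norm_divide[symmetric] norm_of_nat_powr[OF zero_less_Suc, symmetric]
            algebra_simps diff_divide_distrib del: of_nat_Suc norm_of_nat_powr norm_mult norm_divide)
      also have "norm (k z / z) = 2 * Re z / R\<^sup>2"
        unfolding k_def using norm_newman_kernel[OF z(1) R(1)] z(2) by simp
      also have "norm (G z - S (Suc N) z) * (2 * Re z / R\<^sup>2) * real (Suc N) powr Re z \<le>
          C * real (Suc N) powr (- Re z) / Re z * (2 * Re z / R\<^sup>2) * real (Suc N) powr Re z"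
        unfolding S_def using z(2)
        by (intro mult_right_mono norm_dirichlet_tail_le[OF c z(2) _ sums[OF z(2)]]) auto
      also have "\<dots> = 2 * C / R\<^sup>2"
        using z(2) by (simp add: powr_minus field_simps del: of_nat_Suc)
      finally show "norm (F N z - T N z) \<le> 2 * C / R\<^sup>2" .
    qed (use C R in auto)

    have bA': "norm (contour_integral ?A' (T N)) \<le> 2 * C * (R / Suc N + 1) / R\<^sup>2 * R * (3 * pi / 2 - pi / 2)" for N
    proof (rule contour_integral_bound_part_circlepath_strong[where k = "{?a, - ?a}"])
      show "T N contour_integrable_on ?A'"
        using A' R by (intro intT) auto
      fix z assume z: "z \<in> path_image ?A' - {?a, - ?a}"
      then have z: "norm z = R" "Re z < 0" using A' endpts[of z] by force+
      have "norm (T N z) = norm (S (Suc N) z) * norm (k z / z) * real (Suc N) powr Re z"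
        unfolding T_def
        by (simp add: norm_mult norm_divide norm_of_nat_powr[OF zero_less_Suc] del: of_nat_Suc)
      also have "norm (k z / z) = 2 * (- Re z) / R\<^sup>2"
        unfolding k_def using norm_newman_kernel[OF z(1) R(1)] z(2) by simp
      also have "norm (S (Suc N) z) * (2 * (- Re z) / R\<^sup>2) * real (Suc N) powr Re z \<le>
          C * (real (Suc N) powr (- Re z - 1) + real (Suc N) powr (- Re z) / (- Re z)) * (2 * (- Re z) / R\<^sup>2) * real (Suc N) powr Re z"
        unfolding S_def using z(2)
        by (intro mult_right_mono norm_dirichlet_partial_le[OF c z(2)]) (auto intro: divide_nonpos_nonneg)
      also have "\<dots> = 2 * C * (- Re z / Suc N + 1) / R\<^sup>2"
      proof -
        have "C * (inverse P / n + inverse P / (-x)) * (2 * (-x) / R\<^sup>2) * P = 2 * C * (- x / n + 1) / R\<^sup>2"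
          if "P > 0" "n > 0" "x < 0" for P n x :: real
          using that R(1) by (simp add: field_simps)
        from this[of "real (Suc N) powr Re z" "real (Suc N)" "Re z"] show ?thesis
          using z(2) by (simp add: powr_minus powr_diff del: of_nat_Suc)
      qed
      also have "\<dots> \<le> 2 * C * (R / Suc N + 1) / R\<^sup>2"
        using abs_Re_le_cmod[of z] z C
        by (intro divide_right_mono mult_left_mono add_right_mono) auto
      finally show "norm (T N z) \<le> 2 * C * (R / Suc N + 1) / R\<^sup>2" .
    qed (use C R in auto)

    have lim: "(\<lambda>N. contour_integral ?g (F N)) \<longlonglongrightarrow> 0"
    proof -
      have cont: "continuous_on (V - {0}) (\<lambda>z. G z * k z / z)"
        using holG holk[of V] by (intro continuous_intros holomorphic_on_imp_continuous_on) (auto elim: holomorphic_on_subset)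
      have "0 \<notin> path_image ?g" using g by auto
      then have sub: "closed_segment ?a ?b \<subseteq> V - {0}" "closed_segment ?b (- ?a) \<subseteq> V - {0}"
        using g by (auto simp: path_image_join)
      have ab: "?a \<noteq> ?b" "?b \<noteq> - ?a" using R d by (auto simp: complex_eq_iff)
      have 1: "(\<lambda>N. contour_integral (linepath ?a ?b) (F N)) \<longlonglongrightarrow> 0"
        unfolding F_def
      proof (rule tendsto_contour_integral_linepath_left[OF continuous_on_subset[OF cont sub(1)]])
        fix z assume "z \<in> open_segment ?a ?b"
        then show "Re z < 0" using seg1[of z] by (auto simp: open_segment_def)
      qed (use ab d in auto)
      have 2: "(\<lambda>N. contour_integral (linepath ?b (- ?a)) (F N)) \<longlonglongrightarrow> 0"
        unfolding F_def
      proof (rule tendsto_contour_integral_linepath_left[OF continuous_on_subset[OF cont sub(2)]])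
        fix z assume "z \<in> open_segment ?b (- ?a)"
        then show "Re z < 0" using seg2[of z] by (auto simp: open_segment_def)
      qed (use ab d in auto)
      have holF: "F N holomorphic_on V - {0}" for N
        unfolding F_def using holG by (intro holomorphic_intros holk) (auto elim: holomorphic_on_subset simp del: of_nat_Suc)
      have "F N contour_integrable_on linepath ?a ?b" "F N contour_integrable_on linepath ?b (- ?a)" for N
        using contour_integrable_holomorphic_simple[OF holF[of N] open_delete[OF V(1)]] sub by auto
      then have "contour_integral ?g (F N) = contour_integral (linepath ?a ?b) (F N) + contour_integral (linepath ?b (- ?a)) (F N)" for N
        by simp
      then show ?thesis using tendsto_add[OF 1 2] by simp
    qed
    \<comment> \<open>The term C / (N + 1) is the trace of the boundary term in the bound on the
      left half circle.\<close>
    have "(\<lambda>N. C / Suc N + norm (contour_integral ?g (F N))) \<longlonglongrightarrow> 0 + norm (0 :: complex)"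
      by (intro tendsto_add tendsto_norm lim) real_asymp
    then have "\<forall>\<^sub>F N in sequentially. C / Suc N + norm (contour_integral ?g (F N)) < e / 2"
      using e by (intro order_tendstoD(2)) auto
    then show ?thesis
    proof eventually_elim
      case (elim N)
      have diff: "contour_integral ?A (\<lambda>z. F N z - T N z) = contour_integral ?A (F N) - contour_integral ?A (T N)"
        using AV by (intro contour_integral_diff intF intT) auto
      have "2 * pi * \<i> * (G 0 - S (Suc N) 0) =
          contour_integral ?A (\<lambda>z. F N z - T N z) + contour_integral ?g (F N) - contour_integral ?A' (T N)"
        unfolding diff right_diff_distrib F[of N, symmetric] T[of N, symmetric] by simp
      then have "norm (2 * pi * \<i> * (G 0 - S (Suc N) 0)) \<le> 2 * C / R\<^sup>2 * R * (pi / 2 - (-pi / 2)) +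
          norm (contour_integral ?g (F N)) + 2 * C * (R / Suc N + 1) / R\<^sup>2 * R * (3 * pi / 2 - pi / 2)"
        using bA[of N] bA'[of N]
        by (smt (verit, ccfv_SIG) norm_triangle_ineq norm_triangle_ineq4)
      also have "\<dots> = 2 * pi * (2 * C / R + C / Suc N) + norm (contour_integral ?g (F N))"
        using R by (simp add: field_simps power2_eq_square del: of_nat_Suc)
      also have "norm (2 * pi * \<i> * (G 0 - S (Suc N) 0)) = 2 * pi * norm (G 0 - S (Suc N) 0)"
        by (simp add: norm_mult)
      finally have le: "2 * pi * (norm (G 0 - S (Suc N) 0) - (2 * C / R + C / Suc N)) \<le> norm (contour_integral ?g (F N))"
        by (simp add: right_diff_distrib)
      have "x \<le> b" if "2 * pi * x \<le> b" "b \<ge> 0" for x b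
        using that pi_ge_two mult_right_mono[of 1 "2 * pi" x] by (cases "x \<ge> 0") auto
      from this[OF le norm_ge_zero]
      have "norm (G 0 - S (Suc N) 0) - (2 * C / R + C / Suc N) \<le> norm (contour_integral ?g (F N))" .
      then show ?case using elim R(2) by linarith
    qed
  qed
  have "(\<lambda>N. S (Suc N) 0) \<longlonglongrightarrow> G 0"
    unfolding tendsto_iff dist_norm using key by (simp add: norm_minus_commute)
  then have "(\<lambda>N. S N 0) \<longlonglongrightarrow> G 0"
    by (rule LIMSEQ_imp_Suc)
  then show ?thesis unfolding sums_def S_def by (simp del: of_nat_Suc)
qed

section \<open>The Chebyshev function\<close>

definition psi :: "nat \<Rightarrow> real" where
  "psi n = (\<Sum>d\<le>n. mangoldt d)"

lemma mono_psi: "mono psi"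
  unfolding psi_def by (intro monoI sum_mono2) (auto simp: mangoldt_nonneg)

lemma psi_diff: "m \<le> n \<Longrightarrow> psi n - psi m = (\<Sum>d\<in>{m<..n}. mangoldt d)"
proof -
  assume "m \<le> n"
  then have "{..n} = {..m} \<union> {m<..n}" by auto
  then have "psi n = psi m + (\<Sum>d\<in>{m<..n}. mangoldt d)"
    unfolding psi_def by (simp add: sum.union_disjoint ivl_disj_int)
  then show ?thesis by simp
qed

text \<open>Passing from n to n + 1 raises \<open>n div d\<close> exactly for the divisors d of n +
  1, whose \<open>mangoldt\<close> values add up to ln (n + 1). The free upper limit
  \<open>m\<close> allows two factorials to be expanded over the same range.\<close>

lemma ln_fact_conv_mangoldt:
  assumes "n \<le> m"
  shows "ln (fact n :: real) = (\<Sum>d\<in>{1..m}. mangoldt d * real (n div d))"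
  using assms
proof (induction n)
  case (Suc n)
  have "(\<Sum>d\<in>{1..m}. mangoldt d * real (Suc n div d)) =
      (\<Sum>d\<in>{1..m}. mangoldt d * real (n div d) + (if d dvd Suc n then mangoldt d else 0))"
    by (intro sum.cong) (auto simp: div_Suc dvd_eq_mod_eq_0 algebra_simps)
  also have "\<dots> = ln (fact n) + (\<Sum>d\<in>{d\<in>{1..m}. d dvd Suc n}. mangoldt d)"
    using Suc by (simp add: sum.distrib sum.If_cases Int_def)
  also have "{d\<in>{1..m}. d dvd Suc n} = {d. d dvd Suc n}"
    using Suc.prems by (auto dest: dvd_imp_le simp: Suc_le_eq intro: dvd_pos_nat order_trans)
  also have "(\<Sum>d | d dvd Suc n. mangoldt d :: real) = ln (Suc n)"
    using mangoldt_sum[of "Suc n", where ?'a = real] by simp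
  finally show ?case by (simp add: ln_mult add.commute)
qed simp

text \<open>The binomial coefficient accounts for one factor 2^n. The other absorbs
  \<open>Suc k\<close>, which appears when n is odd.\<close>

lemma fact_le_fact_half: "fact n \<le> (4 ^ n * (fact (n div 2))\<^sup>2 :: nat)"
proof -
  define k where "k = n div 2"
  have k: "k \<le> n" "n - k \<le> Suc k" by (auto simp: k_def)
  have "fact n = (n choose k) * (fact k * fact (n - k))"
    using binomial_fact_lemma[OF k(1)] by (simp add: mult_ac)
  also have "fact (n - k) \<le> (fact (Suc k) :: nat)" using k(2) by (rule fact_mono)
  also have "(fact (Suc k) :: nat) \<le> 2 ^ n * fact k"
  proof -
    have "Suc k \<le> 2 ^ k" using less_exp[of k] by linarith
    also have "2 ^ k \<le> (2 ^ n :: nat)" using k(1) by (intro power_increasing) auto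
    finally show ?thesis by (simp only: fact_Suc of_nat_id mult_le_mono1)
  qed
  also have "n choose k \<le> 2 ^ n" by (rule binomial_le_pow2)
  also have "2 ^ n * (fact k * (2 ^ n * fact k)) = (4 ^ n * (fact k)\<^sup>2 :: nat)"
    by (simp add: power2_eq_square mult_ac flip: power_mult_distrib)
  finally show ?thesis by (simp add: k_def)
qed

text \<open>Chebyshev's argument: with k = n div 2, the weight
  \<open>n div d - 2 * (k div d)\<close> is never negative and is at least 1 for k < d <= n. Hence
  psi n - psi k is at most ln (n! / (k!)^2) <= n ln 4 <= 2 n. The constant 4 is the one that halving
  reproduces: 4 (n / 2) + 2 n = 4 n.\<close>

lemma psi_le: "psi n \<le> 4 * real n"
proof (induction n rule: less_induct)
  case (less n)
  show ?case
  proof (cases "n = 0")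
    case False
    define k where "k = n div 2"
    have "psi n - psi k = (\<Sum>d\<in>{1..n}. mangoldt d * (if k < d then 1 else 0))"
      unfolding psi_diff[of k n, unfolded k_def, simplified, folded k_def]
      by (intro sum.mono_neutral_cong_left) auto
    also have "\<dots> \<le> (\<Sum>d\<in>{1..n}. mangoldt d * (real (n div d) - 2 * real (k div d)))"
    proof (intro sum_mono mult_left_mono mangoldt_nonneg)
      fix d assume d: "d \<in> {1..n}"
      have "2 * (k div d) \<le> n div d"
      proof -
        have "2 * (k div d) * d \<le> 2 * k" by simp
        also have "\<dots> \<le> n" by (simp add: k_def)
        finally show ?thesis using d by (simp add: less_eq_div_iff_mult_less_eq)
      qed
      moreover have "n div d \<ge> 1" using d by (simp add: Suc_le_eq div_greater_zero_iff)
      ultimately show "(if k < d then 1 else 0) \<le> real (n div d) - 2 * real (k div d)"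
        by (auto simp: of_nat_diff)
    qed
    finally have "psi n - psi k \<le> (\<Sum>d\<in>{1..n}. mangoldt d * (real (n div d) - 2 * real (k div d)))" .
    also have "\<dots> = ln (fact n) - 2 * ln (fact k)"
      unfolding ln_fact_conv_mangoldt[OF order_refl[of n]] ln_fact_conv_mangoldt[of k n, unfolded k_def, simplified, folded k_def]
      by (simp add: sum_subtractf sum_distrib_left algebra_simps)
    finally have 1: "psi n - psi k \<le> ln (fact n) - 2 * ln (fact k)" .
    have "ln (fact n) \<le> ln (4 ^ n * (fact k)\<^sup>2 :: real)"
    proof -
      have "real (fact n) \<le> real (4 ^ n * (fact k)\<^sup>2)"
        using fact_le_fact_half[of n] unfolding k_def of_nat_le_iff .
      then show ?thesis by (subst ln_le_cancel_iff) auto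
    qed
    also have "\<dots> = real n * ln 4 + 2 * ln (fact k)"
      by (simp add: ln_mult ln_realpow)
    also have "real n * ln 4 \<le> real n * 2"
      using ln_add_one_self_le_self2[of "1 :: real"] ln_realpow[of 2 2] by (intro mult_left_mono) simp_all
    finally have "psi n \<le> psi k + 2 * real n" using 1 by linarith
    also have "psi k \<le> 4 * real k" using less[of k] False by (simp add: k_def)
    also have "2 * k \<le> n" by (simp add: k_def)
    then have "4 * real k \<le> 2 * real n" by linarith
    finally show ?thesis by simp
  qed (simp add: psi_def)
qed

lemma psi_nonneg: "psi n \<ge> 0"
  unfolding psi_def by (intro sum_nonneg mangoldt_nonneg)

section \<open>From the growth of psi to primes in short intervals\<close>

text \<open>Only proper prime powers p^k with p <= sqrt n and k <= log 2 n remain, and each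
  contributes at most ln n. The total is o(n).\<close>

lemma psi_diff_le_no_prime:
  assumes "0 < m" "m \<le> n" and np: "\<And>p. prime p \<Longrightarrow> p \<notin> {m<..n}"
  shows "psi n - psi m \<le> sqrt n * (log 2 n + 1) * ln n"
proof -
  let ?S = "{d\<in>{m<..n}. primepow d}"
  let ?P = "{1..nat \<lfloor>sqrt n\<rfloor>}" and ?K = "{..nat \<lfloor>log 2 n\<rfloor>}"
  have "?S \<subseteq> (\<lambda>(p, k). p ^ k) ` (?P \<times> ?K)"
  proof
    fix d assume d: "d \<in> ?S"
    then obtain p k where pk: "prime p" "k > 0" "d = p ^ k" by (auto simp: primepow_def)
    then have "k \<noteq> 1" using np[of p] d by auto
    then have k: "k \<ge> 2" using pk by simp
    have p: "p \<ge> 2" using pk prime_ge_2_nat by blast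
    have "p ^ 2 \<le> p ^ k" using k p by (intro power_increasing) auto
    then have "p\<^sup>2 \<le> n" using d pk by simp
    then have "real p \<le> sqrt n" by (metis of_nat_mono of_nat_power real_le_rsqrt)
    then have 1: "p \<in> ?P" using p by (simp add: le_nat_floor)
    have "2 ^ k \<le> p ^ k" using p by (intro power_mono) auto
    then have "2 ^ k \<le> n" using order_trans[of "2 ^ k" "p ^ k" n] d pk by auto
    then have "real k \<le> log 2 n"
      by (metis le_log2_of_power of_nat_mono)
    then have 2: "k \<in> ?K" by (simp add: le_nat_floor)
    show "d \<in> (\<lambda>(p, k). p ^ k) ` (?P \<times> ?K)"
      using 1 2 pk by auto
  qed
  then have "card ?S \<le> card (?P \<times> ?K)"
    by (intro surj_card_le) auto
  then have "card ?S \<le> nat \<lfloor>sqrt n\<rfloor> * (nat \<lfloor>log 2 n\<rfloor> + 1)"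
    by (simp only: card_cartesian_product) simp
  then have "real (card ?S) \<le> real (nat \<lfloor>sqrt n\<rfloor> * (nat \<lfloor>log 2 n\<rfloor> + 1))"
    by (rule of_nat_mono)
  also have "\<dots> = real (nat \<lfloor>sqrt n\<rfloor>) * (real (nat \<lfloor>log 2 n\<rfloor>) + 1)"
    by (simp only: of_nat_mult of_nat_add of_nat_1)
  also have "\<dots> \<le> sqrt n * (log 2 n + 1)"
    using assms by (intro mult_mono add_right_mono) (auto simp: of_nat_floor)
  finally have card: "real (card ?S) \<le> sqrt n * (log 2 n + 1)" .
  have "psi n - psi m = (\<Sum>d\<in>?S. mangoldt d)"
    unfolding psi_diff[OF assms(2)] by (intro sum.mono_neutral_right) (auto simp: mangoldt_def)
  also have "\<dots> \<le> (\<Sum>d\<in>?S. ln n)"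
  proof (rule sum_mono)
    fix d assume "d \<in> ?S"
    then have "d > 0" "real d \<le> real n" using assms(1) by auto
    then have "ln (real d) \<le> ln (real n)" by (subst ln_le_cancel_iff) auto
    then show "mangoldt d \<le> ln (real n)" using mangoldt_le[of d] \<open>d > 0\<close> by linarith
  qed
  also have "\<dots> = real (card ?S) * ln n" by simp
  also have "\<dots> \<le> sqrt n * (log 2 n + 1) * ln n"
    using card assms by (intro mult_right_mono) auto
  finally show ?thesis .
qed

text \<open>If \<open>a\<close> exceeded \<eta> m on the whole window, the window would contribute a
  fixed positive amount to the series, against Cauchy's criterion.\<close>

lemma summable_imp_small_in_window:
  fixes a :: "nat \<Rightarrow> real"
  assumes sum: "summable (\<lambda>n. a n / (real n)\<^sup>2)" and pos: "\<delta> > 0" "\<eta> > 0"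
  shows "\<forall>\<^sub>F m in sequentially. \<exists>n>m. real n \<le> (1 + \<delta>) * real m \<and> a n \<le> \<eta> * real m"
proof -
  \<comment> \<open>About \<delta> m terms, each at least \<eta> m / ((1 + \<delta>) m)^2; the
    factor 2 allows for rounding the window, which is harmless once \<delta> m > 2.\<close>
  define \<kappa> where "\<kappa> = \<eta> * \<delta> / (2 * (1 + \<delta>)\<^sup>2)"
  have \<kappa>: "\<kappa> > 0" using pos by (simp add: \<kappa>_def)
  obtain N where N: "\<And>m n. m \<ge> N \<Longrightarrow> norm (\<Sum>k\<in>{m..<n}. a k / (real k)\<^sup>2) < \<kappa>"
    using sum \<kappa> unfolding summable_Cauchy by metis
  have "\<forall>\<^sub>F m in sequentially. real m > max (real N) (2 / \<delta>)"
    using filterlim_real_sequentially unfolding filterlim_at_top_dense by blast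
  then show ?thesis
  proof eventually_elim
    case (elim m)
    define M where "M = nat \<lfloor>(1 + \<delta>) * real m\<rfloor>"
    have m: "m > 0" using elim by auto
    have M: "real M \<le> (1 + \<delta>) * real m" "real M > (1 + \<delta>) * real m - 1"
      using pos unfolding M_def by (auto simp: of_nat_floor)
    have dm: "\<delta> * real m > 2" using elim pos by (simp add: field_simps)
    have Mm: "real M - real m \<ge> \<delta> * real m / 2" using M(2) dm by (simp add: algebra_simps)
    then have mM: "m < M" using dm by linarith
    show ?case
    proof (rule ccontr)
      assume *: "\<not> ?case"
      have "real (M - m) * (\<eta> * real m / (real M)\<^sup>2) = (\<Sum>k\<in>{Suc m..<Suc M}. \<eta> * real m / (real M)\<^sup>2)"
        by simp
      also have "\<dots> \<le> (\<Sum>k\<in>{Suc m..<Suc M}. a k / (real k)\<^sup>2)"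
      proof (rule sum_mono)
        fix k assume k: "k \<in> {Suc m..<Suc M}"
        then have "real k \<le> real M" by simp
        then have "real k \<le> (1 + \<delta>) * real m" using M(1) by linarith
        then have "\<eta> * real m \<le> a k" using * k by force
        then show "\<eta> * real m / (real M)\<^sup>2 \<le> a k / (real k)\<^sup>2"
          using k pos by (intro frac_le power_mono) (auto intro: order_trans[rotated])
      qed
      also have "\<dots> < \<kappa>" using N[of "Suc m" "Suc M"] elim by simp
      finally have "real (M - m) * (\<eta> * real m / (real M)\<^sup>2) < \<kappa>" .
      moreover have "\<kappa> = (\<delta> * real m / 2) * (\<eta> * real m / ((1 + \<delta>) * real m)\<^sup>2)"
      proof -
        have "\<eta> * \<delta> / (2 * D) = (\<delta> * x / 2) * (\<eta> * x / (D * x\<^sup>2))" if "x > 0" "D > 0" for x D :: real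
          using that by (simp add: field_simps power2_eq_square)
        from this[of "real m" "(1 + \<delta>)\<^sup>2"] show ?thesis
          using m pos by (simp add: \<kappa>_def power_mult_distrib)
      qed
      moreover have "(\<delta> * real m / 2) * (\<eta> * real m / ((1 + \<delta>) * real m)\<^sup>2) \<le> real (M - m) * (\<eta> * real m / (real M)\<^sup>2)"
        using Mm mM M(1) pos m by (intro mult_mono frac_le power_mono) auto
      ultimately show False by simp
    qed
  qed
qed

text \<open>A window just above m contains a point where psi is not too large, and monotonicity
  carries the bound back: psi m <= (1 + \<epsilon>/4) m. A second window above (1 + \<epsilon>/2) m
  contains some n2 with psi n2 >= (1 + 3 \<epsilon>/8) m. The growth \<epsilon> m / 8 in between is
  more than proper prime powers can provide.\<close>

lemma primes_in_short_intervals_if_summable: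
  fixes \<epsilon> :: real
  assumes sum: "summable (\<lambda>n. (psi n - real n) / (real n)\<^sup>2)" and \<epsilon>: "0 < \<epsilon>" "\<epsilon> \<le> 1"
  shows "\<forall>\<^sub>F m in sequentially. \<exists>p. prime p \<and> m < p \<and> real p \<le> (1 + \<epsilon>) * real m"
proof -
  define m' where "m' = (\<lambda>m. nat \<lceil>(1 + \<epsilon> / 2) * real m\<rceil>)"
  have m': "(1 + \<epsilon> / 2) * real m \<le> real (m' m)" "real (m' m) \<le> (1 + \<epsilon> / 2) * real m + 1" for m
  proof -
    have "0 \<le> (1 + \<epsilon> / 2) * real m" using \<epsilon> by simp
    then show "(1 + \<epsilon> / 2) * real m \<le> real (m' m)" "real (m' m) \<le> (1 + \<epsilon> / 2) * real m + 1"
      unfolding m'_def by linarith+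
  qed
  have "filterlim (\<lambda>m. (1 + \<epsilon> / 2) * real m) at_top sequentially"
    using \<epsilon> by real_asymp
  then have "filterlim (\<lambda>m. real (m' m)) at_top sequentially"
    by (rule filterlim_at_top_mono) (use m' in auto)
  then have lim: "filterlim m' at_top sequentially"
    unfolding filterlim_sequentially_iff_filterlim_real .
  have neg: "summable (\<lambda>n. (real n - psi n) / (real n)\<^sup>2)"
    using summable_minus[OF sum] by (simp add: minus_divide_left)
  have "\<forall>\<^sub>F m in sequentially. \<exists>n>m. real n \<le> (1 + \<epsilon>/6) * real m \<and> psi n - real n \<le> \<epsilon>/12 * real m"
    using sum \<epsilon> by (intro summable_imp_small_in_window) auto
  moreover have "\<forall>\<^sub>F m in sequentially. \<exists>n>m' m. real n \<le> (1 + \<epsilon>/6) * real (m' m) \<and> real n - psi n \<le> \<epsilon>/12 * real (m' m)"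
    using neg \<epsilon> by (intro eventually_compose_filterlim[OF summable_imp_small_in_window lim]) auto
  moreover have "\<forall>\<^sub>F m in sequentially. sqrt (2 * real m) * (log 2 (2 * real m) + 1) * ln (2 * real m) < \<epsilon> / 8 * real m"
    using \<epsilon> by real_asymp
  moreover have "\<forall>\<^sub>F m in sequentially. 2 < \<epsilon> / 4 * real m"
    using \<epsilon> by real_asymp
  ultimately show ?thesis
  proof eventually_elim
    case (elim m)
    then obtain n1 n2 where n1: "n1 > m" "real n1 \<le> (1 + \<epsilon>/6) * real m" "psi n1 - real n1 \<le> \<epsilon>/12 * real m"
      and n2: "n2 > m' m" "real n2 \<le> (1 + \<epsilon>/6) * real (m' m)" "real n2 - psi n2 \<le> \<epsilon>/12 * real (m' m)"
      by blast
    have m: "m > 0" using elim(4) by (intro Nat.gr0I) auto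
    have "psi m \<le> psi n1" using mono_psi n1 by (simp add: monoD)
    then have 1: "psi m \<le> (1 + \<epsilon> / 4) * real m"
      using n1 by (simp add: algebra_simps)
    have "real (m' m) * (1 - \<epsilon> / 12) \<le> psi n2"
      using n2 by (simp add: algebra_simps)
    moreover have "real (m' m) * (1 - \<epsilon> / 12) \<ge> (1 + \<epsilon> / 2) * real m * (1 - \<epsilon> / 12)"
      using m' \<epsilon> by (intro mult_right_mono) auto
    moreover have "(1 + \<epsilon> / 2) * (1 - \<epsilon> / 12) \<ge> 1 + 3 * \<epsilon> / 8"
    proof -
      have "(1 + \<epsilon> / 2) * (1 - \<epsilon> / 12) = 1 + 5 * \<epsilon> / 12 - \<epsilon> * \<epsilon> / 24"
        by (simp add: field_simps)
      then show ?thesis using mult_left_mono[OF \<epsilon>(2), of \<epsilon>] \<epsilon>(1) by linarith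
    qed
    then have "(1 + \<epsilon> / 2) * (1 - \<epsilon> / 12) * real m \<ge> (1 + 3 * \<epsilon> / 8) * real m"
      by (rule mult_right_mono) simp
    ultimately have 2: "psi n2 \<ge> (1 + 3 * \<epsilon> / 8) * real m"
      by (simp add: mult_ac)
    have "real n2 \<le> (1 + \<epsilon>/6) * ((1 + \<epsilon> / 2) * real m + 1)"
      using n2(2) m'(2)[of m] \<epsilon> by (meson add_nonneg_nonneg divide_nonneg_pos less_imp_le mult_left_mono order_trans zero_less_numeral zero_le_one)
    also have "\<dots> = (1 + \<epsilon>/6) * (1 + \<epsilon> / 2) * real m + (1 + \<epsilon> / 6)"
      by (simp add: field_simps)
    also have "\<dots> \<le> (1 + 3 * \<epsilon> / 4) * real m + (1 + \<epsilon> / 6)"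
    proof (intro add_right_mono mult_right_mono)
      have "(1 + \<epsilon>/6) * (1 + \<epsilon> / 2) = 1 + 2 * \<epsilon> / 3 + \<epsilon> * \<epsilon> / 12"
        by (simp add: field_simps)
      then show "(1 + \<epsilon>/6) * (1 + \<epsilon> / 2) \<le> 1 + 3 * \<epsilon> / 4"
        using mult_left_mono[OF \<epsilon>(2), of \<epsilon>] \<epsilon>(1) by linarith
    qed simp
    also have "\<dots> \<le> (1 + 3 * \<epsilon> / 4) * real m + \<epsilon> / 4 * real m" using elim(4) \<epsilon> by simp
    also have "\<dots> = (1 + \<epsilon>) * real m" by (simp add: algebra_simps)
    finally have n2m: "real n2 \<le> (1 + \<epsilon>) * real m" .
    show ?case
    proof (rule ccontr)
      assume no: "\<not> ?case"
      have "real m \<le> real (m' m)" using m'(1)[of m] \<epsilon> mult_nonneg_nonneg[of "\<epsilon> / 2" "real m"]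
        unfolding distrib_right mult_1 by linarith
      then have mn2: "m < n2" using n2(1) by simp
      have "psi n2 - psi m \<le> sqrt n2 * (log 2 n2 + 1) * ln n2"
      proof (rule psi_diff_le_no_prime)
        fix p :: nat assume p: "prime p"
        show "p \<notin> {m<..n2}"
        proof
          assume "p \<in> {m<..n2}"
          then have "m < p" "real p \<le> (1 + \<epsilon>) * real m" using n2m by auto
          then show False using no p by blast
        qed
      qed (use mn2 m in auto)
      also have "\<dots> \<le> sqrt (2 * real m) * (log 2 (2 * real m) + 1) * ln (2 * real m)"
      proof -
        have "real n2 \<le> 2 * real m"
          using n2m mult_right_mono[OF \<epsilon>(2), of "real m"] by (simp add: algebra_simps)
        then show ?thesis using mn2 m by (intro mult_mono add_right_mono) auto
      qed
      finally have "psi n2 - psi m < \<epsilon> / 8 * real m" using elim(3) by linarith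
      then show False using 1 2 by (simp add: algebra_simps)
    qed
  qed
qed

section \<open>The zeta function on the line \<open>Re s = 1\<close>\<close>

text \<open>Weierstrass' theorem under local domination. The termwise derivatives are recorded
  because the series of \<open>deriv zeta\<close> has to be identified.\<close>

lemma series_holomorphic:
  fixes f :: "nat \<Rightarrow> complex \<Rightarrow> complex"
  assumes S: "open S" and hol: "\<And>n. f n holomorphic_on S"
    and bd: "\<And>x. x \<in> S \<Longrightarrow> \<exists>d h. 0 < d \<and> summable h \<and> (\<forall>n. \<forall>y\<in>ball x d \<inter> S. norm (f n y) \<le> h n)"
  shows "\<And>x. x \<in> S \<Longrightarrow> summable (\<lambda>n. f n x)"
    and "(\<lambda>x. \<Sum>n. f n x) holomorphic_on S"
    and "\<And>x. x \<in> S \<Longrightarrow> (\<lambda>n. deriv (f n) x) sums deriv (\<lambda>x. \<Sum>n. f n x) x"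
proof -
  have "\<exists>g g'. \<forall>x \<in> S. ((\<lambda>n. f n x) sums g x) \<and> ((\<lambda>n. deriv (f n) x) sums g' x) \<and> (g has_field_derivative g' x) (at x)"
  proof (rule series_and_derivative_comparison_local[OF S])
    show "(f n has_field_derivative deriv (f n) x) (at x)" if "x \<in> S" for n x
      using holomorphic_derivI[OF hol S that] .
    show "\<exists>d h. 0 < d \<and> summable h \<and> (\<forall>\<^sub>F n in sequentially. \<forall>y\<in>ball x d \<inter> S. norm (f n y) \<le> h n)"
      if "x \<in> S" for x
    proof -
      obtain d h where "0 < d" "summable h" "\<forall>n. \<forall>y\<in>ball x d \<inter> S. norm (f n y) \<le> h n"
        using bd[OF \<open>x \<in> S\<close>] by blast
      then show ?thesis by (intro exI[of _ d] exI[of _ h]) simp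
    qed
  qed
  then obtain g g' where g: "\<And>x. x \<in> S \<Longrightarrow> (\<lambda>n. f n x) sums g x"
    "\<And>x. x \<in> S \<Longrightarrow> (\<lambda>n. deriv (f n) x) sums g' x"
    "\<And>x. x \<in> S \<Longrightarrow> (g has_field_derivative g' x) (at x)" by blast
  show "summable (\<lambda>n. f n x)" if "x \<in> S" for x
    using g(1)[OF that] by (rule sums_summable)
  have eq: "(\<Sum>n. f n x) = g x" if "x \<in> S" for x
    using g(1)[OF that] by (simp add: sums_iff)
  have der: "((\<lambda>x. \<Sum>n. f n x) has_field_derivative g' x) (at x)" if "x \<in> S" for x
    using has_field_derivative_transform_within_open[OF g(3)[OF that] S that] eq by metis
  then show "(\<lambda>x. \<Sum>n. f n x) holomorphic_on S"
    using S by (auto simp: holomorphic_on_open)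
  show "(\<lambda>n. deriv (f n) x) sums deriv (\<lambda>x. \<Sum>n. f n x) x" if "x \<in> S" for x
    using g(2)[OF that] DERIV_imp_deriv[OF der[OF that]] by simp
qed

lemma summable_ln_powr:
  assumes "r > 1"
  shows "summable (\<lambda>n. (1 + ln (real (Suc n))) * real (Suc n) powr (-r))"
proof (rule summable_comparison_test)
  \<comment> \<open>Half of the excess of r over 1: the logarithm is absorbed by the power \<theta>,
    and \<theta> - r is still below -1.\<close>
  define \<theta> where "\<theta> = (r - 1) / 2"
  have \<theta>: "\<theta> > 0" using assms by (simp add: \<theta>_def)
  have "summable (\<lambda>n. real n powr (\<theta> - r))"
    using assms by (subst summable_real_powr_iff) (auto simp: \<theta>_def field_simps)
  then have "summable (\<lambda>n. real (Suc n) powr (\<theta> - r))" by (subst summable_Suc_iff)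
  then show "summable (\<lambda>n. (1 + 1 / \<theta>) * real (Suc n) powr (\<theta> - r))" by (rule summable_mult)
  show "\<exists>N. \<forall>n\<ge>N. norm ((1 + ln (real (Suc n))) * real (Suc n) powr (-r)) \<le> (1 + 1 / \<theta>) * real (Suc n) powr (\<theta> - r)"
  proof (intro exI[of _ 0] allI impI)
    fix n
    have "ln (real (Suc n)) \<le> real (Suc n) powr \<theta> / \<theta>"
      using \<theta> by (intro ln_powr_bound) auto
    moreover have "1 \<le> real (Suc n) powr \<theta>"
      using \<theta> by (intro ge_one_powr_ge_zero) auto
    ultimately have "1 + ln (real (Suc n)) \<le> (1 + 1 / \<theta>) * real (Suc n) powr \<theta>"
      by (simp add: algebra_simps)
    then have "(1 + ln (real (Suc n))) * real (Suc n) powr (-r) \<le> (1 + 1 / \<theta>) * real (Suc n) powr \<theta> * real (Suc n) powr (-r)"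
      by (rule mult_right_mono) simp
    also have "\<dots> = (1 + 1 / \<theta>) * real (Suc n) powr (\<theta> - r)"
      by (simp add: powr_diff powr_minus field_simps)
    finally show "norm ((1 + ln (real (Suc n))) * real (Suc n) powr (-r)) \<le> (1 + 1 / \<theta>) * real (Suc n) powr (\<theta> - r)"
      by simp
  qed
qed

definition dirichlet :: "(nat \<Rightarrow> real) \<Rightarrow> complex \<Rightarrow> complex" where
  "dirichlet a s = (\<Sum>n. of_real (a (Suc n)) * of_nat (Suc n) powr (-s))"

text \<open>The growth bound is chosen to cover both coefficient sequences in use, the constant 1
  and \<open>mangoldt\<close>.\<close>

context
  fixes a :: "nat \<Rightarrow> real"
  assumes a: "\<And>n. \<bar>a (Suc n)\<bar> \<le> 1 + ln (real (Suc n))"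
begin

lemma norm_dirichlet_term_le:
  assumes "r \<le> Re s"
  shows "norm (of_real (a (Suc n)) * of_nat (Suc n) powr (-s)) \<le> (1 + ln (real (Suc n))) * real (Suc n) powr (-r)"
proof -
  have "real (Suc n) powr (- Re s) \<le> real (Suc n) powr (-r)"
    using assms by (intro powr_mono) auto
  then show ?thesis
    unfolding norm_mult norm_of_nat_powr[OF zero_less_Suc] using a[of n]
    by (intro mult_mono) (auto intro: order_trans[OF abs_ge_zero])
qed

lemma dirichlet_bound_local:
  assumes "x \<in> {s. Re s > 1}"
  shows "\<exists>d h. 0 < d \<and> summable h \<and>
    (\<forall>n. \<forall>y\<in>ball x d \<inter> {s. Re s > 1}. norm (of_real (a (Suc n)) * of_nat (Suc n) powr (-y)) \<le> h n)"
proof -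
  define r where "r = (Re x + 1) / 2"
  have "r > 1" "Re x - r > 0" using assms by (auto simp: r_def field_simps)
  moreover have "r \<le> Re y" if "y \<in> ball x (Re x - r)" for y
    using that abs_Re_le_cmod[of "x - y"] by (auto simp: dist_norm)
  ultimately have "\<forall>n. \<forall>y\<in>ball x (Re x - r) \<inter> {s. Re s > 1}.
      norm (of_real (a (Suc n)) * of_nat (Suc n) powr (-y)) \<le> (1 + ln (real (Suc n))) * real (Suc n) powr (-r)"
    by (intro allI ballI norm_dirichlet_term_le) (elim IntE)
  then show ?thesis
    using summable_ln_powr[OF \<open>r > 1\<close>] \<open>Re x - r > 0\<close> by (intro exI conjI)
qed

lemma dirichlet_abs_summable:
  assumes "Re s > 1"
  shows "summable (\<lambda>n. norm (of_real (a (Suc n)) * of_nat (Suc n) powr (-s)))"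
proof (rule summable_comparison_test[OF _ summable_ln_powr[OF assms]], intro exI allI impI)
  show "norm (norm (of_real (a (Suc n)) * of_nat (Suc n) powr (-s))) \<le>
      (1 + ln (real (Suc n))) * real (Suc n) powr (- Re s)" for n
    unfolding real_norm_def abs_norm_cancel by (rule norm_dirichlet_term_le[OF order_refl])
qed

lemma dirichlet_sums:
  assumes "Re s > 1"
  shows "(\<lambda>n. of_real (a (Suc n)) * of_nat (Suc n) powr (-s)) sums dirichlet a s"
  unfolding dirichlet_def
  by (rule summable_sums[OF summable_norm_cancel[OF dirichlet_abs_summable[OF assms]]])

lemma holomorphic_dirichlet: "dirichlet a holomorphic_on {s. Re s > 1}"
  and deriv_dirichlet_sums: "Re s > 1 \<Longrightarrow>
    (\<lambda>n. - of_real (a (Suc n) * ln (Suc n)) * of_nat (Suc n) powr (-s)) sums deriv (dirichlet a) s"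
proof -
  have der: "((\<lambda>s. of_real (a (Suc n)) * of_nat (Suc n) powr (-s)) has_field_derivative
      - of_real (a (Suc n) * ln (Suc n)) * of_nat (Suc n) powr (-s)) (at s)" for n and s :: complex
  proof -
    have "((\<lambda>s. of_nat (Suc n) powr (-s)) has_field_derivative
        (Ln (of_nat (Suc n)) * of_nat (Suc n) powr (-s)) * (-1)) (at s)"
      by (rule DERIV_chain2[OF has_field_derivative_powr_right DERIV_minus[OF DERIV_ident]]) (simp del: of_nat_Suc)
    from DERIV_cmult[OF this, of "of_real (a (Suc n))"] show ?thesis
      by (simp add: Ln_of_nat[OF zero_less_Suc] mult_ac del: of_nat_Suc)
  qed
  have hol: "(\<lambda>s. of_real (a (Suc n)) * of_nat (Suc n) powr (-s)) holomorphic_on {s. Re s > 1}" for n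
    unfolding holomorphic_on_open[OF open_halfspace_Re_gt] using der by blast
  note * = series_holomorphic[OF open_halfspace_Re_gt hol dirichlet_bound_local]
  show "dirichlet a holomorphic_on {s. Re s > 1}"
    using *(2) unfolding dirichlet_def[abs_def] .
  show "(\<lambda>n. - of_real (a (Suc n) * ln (Suc n)) * of_nat (Suc n) powr (-s)) sums deriv (dirichlet a) s" if "Re s > 1"
    using *(3)[of s] that unfolding dirichlet_def[abs_def] DERIV_imp_deriv[OF der] by simp
qed

end

abbreviation zeta :: "complex \<Rightarrow> complex" where
  "zeta \<equiv> dirichlet (\<lambda>_. 1)"

abbreviation mangoldt_series :: "complex \<Rightarrow> complex" where
  "mangoldt_series \<equiv> dirichlet mangoldt"

lemma abs_one_le: "\<bar>1::real\<bar> \<le> 1 + ln (real (Suc n))" by simp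

lemma abs_mangoldt_le: "\<bar>mangoldt (Suc n) :: real\<bar> \<le> 1 + ln (real (Suc n))"
  using mangoldt_le[of "Suc n"] by simp

lemma of_nat_mult_powr:
  "of_nat (m * n) powr z = (of_nat m powr z * of_nat n powr z :: complex)"
  by (cases "m = 0 \<or> n = 0") (auto simp: powr_times_real)

text \<open>Multiplying the two absolutely convergent series and collecting the terms with d * e = n
  yields the coefficients ln n, by \<open>mangoldt_sum\<close>; these belong to -zeta'. Unordered
  sums over pairs justify the rearrangement.\<close>

lemma deriv_zeta:
  assumes s: "Re s > 1"
  shows "deriv zeta s = - zeta s * mangoldt_series s"
proof -
  let ?f = "\<lambda>n. of_nat n powr (-s) :: complex" and ?g = "\<lambda>n. of_real (mangoldt n) * of_nat n powr (-s) :: complex"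
  have Suc: "bij_betw Suc UNIV {1..}"
    unfolding bij_betw_def by (auto simp: image_iff Suc_le_eq gr0_conv_Suc)
  have f: "(?f has_sum zeta s) {1..}" "(?g has_sum mangoldt_series s) {1..}"
    and abs: "(\<lambda>n. norm (?f n)) summable_on {1..}" "(\<lambda>n. norm (?g n)) summable_on {1..}"
  proof -
    have *: "(h has_sum l) {1..} \<and> (\<lambda>n. norm (h n)) summable_on {1..}"
      if "summable (\<lambda>n. norm (h (Suc n)))" "(\<lambda>n. h (Suc n)) sums l" for h :: "nat \<Rightarrow> complex" and l
    proof
      show "(h has_sum l) {1..}"
        using norm_summable_imp_has_sum[OF that] by (rule has_sum_reindex_bij_betw[OF Suc, THEN iffD1])
      have "(\<lambda>n. norm (h (Suc n))) summable_on UNIV"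
        using that(1) by (intro norm_summable_imp_summable_on) simp
      then show "(\<lambda>n. norm (h n)) summable_on {1..}"
        by (rule summable_on_reindex_bij_betw[OF Suc, THEN iffD1])
    qed
    have f: "summable (\<lambda>n. norm (?f (Suc n)))" "(\<lambda>n. ?f (Suc n)) sums zeta s"
      using dirichlet_abs_summable[where a = "\<lambda>_. 1", OF abs_one_le s] dirichlet_sums[where a = "\<lambda>_. 1", OF abs_one_le s]
      by (simp_all only: of_real_1 mult_1)
    note g = dirichlet_abs_summable[where a = mangoldt, OF abs_mangoldt_le s] dirichlet_sums[where a = mangoldt, OF abs_mangoldt_le s]
    show "(?f has_sum zeta s) {1..}" "(\<lambda>n. norm (?f n)) summable_on {1..}"
      using *[OF f] by blast+
    show "(?g has_sum mangoldt_series s) {1..}" "(\<lambda>n. norm (?g n)) summable_on {1..}"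
      using *[of ?g, OF g] by blast+
  qed
  have prod: "((\<lambda>(d, e). ?g d * ?f e) has_sum mangoldt_series s * zeta s) ({1..} \<times> {1..})"
  proof (rule has_sum_SigmaI)
    show "((\<lambda>e. case (d, e) of (d, e) \<Rightarrow> ?g d * ?f e) has_sum ?g d * zeta s) {1..}" for d
      using has_sum_cmult_right[OF f(1), of "?g d"] by simp
    show "((\<lambda>d. ?g d * zeta s) has_sum mangoldt_series s * zeta s) {1..}"
      using has_sum_cmult_left[OF f(2)] .
    have "(\<lambda>e. norm (?g d * ?f e)) summable_on {1..}" for d
      unfolding norm_mult by (rule summable_on_cmult_right[OF abs(1)])
    moreover have "(\<lambda>d. \<Sum>\<^sub>\<infinity>e\<in>{1..}. norm (?g d * ?f e)) summable_on {1..}"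
      unfolding norm_mult infsum_cmult_right' by (rule summable_on_cmult_left[OF abs(2)[unfolded norm_mult]])
    ultimately have "(\<lambda>(d, e). norm (?g d * ?f e)) summable_on {1..} \<times> {1..}"
      by (intro summable_on_SigmaI[where g = "\<lambda>d. \<Sum>\<^sub>\<infinity>e\<in>{1..}. norm (?g d * ?f e)"]) auto
    then have "(\<lambda>x. norm (case x of (d, e) \<Rightarrow> ?g d * ?f e)) summable_on {1..} \<times> {1..}"
      by (simp add: case_prod_unfold)
    then show "(\<lambda>(d, e). ?g d * ?f e) summable_on {1..} \<times> {1..}"
      by (rule abs_summable_summable)
  qed
  have "((\<lambda>(d, e). ?g d * ?f e) has_sum mangoldt_series s * zeta s) ({1..} \<times> {1..}) =
      ((\<lambda>(n, d). ?g d * ?f (n div d)) has_sum mangoldt_series s * zeta s) (SIGMA n:{1..}. {d. d dvd n})"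
    by (rule has_sum_reindex_bij_witness[of _ "\<lambda>(n, d). (d, n div d)" "\<lambda>(d, e). (d * e, d)"])
       (auto simp: Suc_le_eq elim!: dvdE intro: Nat.gr0I)
  with prod have "((\<lambda>(n, d). ?g d * ?f (n div d)) has_sum mangoldt_series s * zeta s) (SIGMA n:{1..}. {d. d dvd n})"
    by blast
  then have "((\<lambda>n. of_real (ln (real n)) * ?f n) has_sum mangoldt_series s * zeta s) {1..}"
  proof (rule has_sum_SigmaD)
    fix n :: nat assume n: "n \<in> {1..}"
    have "(\<Sum>d | d dvd n. ?g d * ?f (n div d)) = (\<Sum>d | d dvd n. of_real (mangoldt d) * ?f n)"
    proof (intro sum.cong refl)
      fix d assume "d \<in> {d. d dvd n}"
      then show "?g d * ?f (n div d) = of_real (mangoldt d) * ?f n"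
        using of_nat_mult_powr[of d "n div d" "-s"] by simp
    qed
    also have "\<dots> = of_real (ln (real n)) * ?f n"
      using mangoldt_sum[of n, where ?'a = complex] n by (simp flip: sum_distrib_right)
    finally show "((\<lambda>d. case (n, d) of (n, d) \<Rightarrow> ?g d * ?f (n div d)) has_sum of_real (ln (real n)) * ?f n) {d. d dvd n}"
      using n by (intro has_sum_finiteI) auto
  qed
  then have "((\<lambda>n. of_real (ln (real (Suc n))) * ?f (Suc n)) has_sum mangoldt_series s * zeta s) UNIV"
    using has_sum_reindex_bij_betw[OF Suc, of "\<lambda>n. of_real (ln (real n)) * ?f n"] by simp
  from sums_minus[OF has_sum_imp_sums[OF this]]
  have "(\<lambda>n. - of_real (ln (real (Suc n))) * ?f (Suc n)) sums (- zeta s * mangoldt_series s)"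
    by (simp add: mult.commute)
  moreover have "(\<lambda>n. - of_real (ln (real (Suc n))) * ?f (Suc n)) sums deriv zeta s"
    using deriv_dirichlet_sums[OF abs_one_le s] by simp
  ultimately show ?thesis using sums_unique2 by blast
qed

text \<open>
  The error of the approximation \<open>n powr (-s) - (n + 1) powr (-s) \<approx> s n powr (-s - 1)\<close>. It gains one power of
  \<open>n\<close>, so \<open>\<Sum> A n * (error)\<close> converges for \<open>Re s > 0\<close> when \<open>A n = O(n)\<close>.
\<close>

definition abel_term :: "nat \<Rightarrow> complex \<Rightarrow> complex" where
  "abel_term n s = of_nat (Suc n) powr (-s) - of_nat (Suc (Suc n)) powr (-s) - s * of_nat (Suc n) powr (-s - 1)"

definition abel_sum :: "(nat \<Rightarrow> real) \<Rightarrow> complex \<Rightarrow> complex" where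
  "abel_sum A s = (\<Sum>n. of_real (A (Suc n)) * abel_term n s)"

text \<open>Up to sign, \<open>abel_term n s\<close> is the first-order Taylor remainder of x powr
  (-s) from n + 1 to n + 2. The second derivative is largest in norm at the left end.\<close>

lemma norm_abel_term_le:
  assumes s: "Re s > 0"
  shows "norm (abel_term n s) \<le> norm s * norm (s + 1) * real (Suc n) powr (- Re s - 2)"
proof -
  define a where "a = complex_of_nat (Suc n)"
  define f where "f = (\<lambda>i x. if i = 0 then x powr (-s) else if i = Suc 0 then - s * x powr (-s - 1)
     else s * (s + 1) * x powr (-s - 2) :: complex)"
  have seg: "x \<in> \<real> \<and> Re x \<ge> real (Suc n)" if "x \<in> closed_segment a (a + 1)" for x
  proof -
    from that obtain u where u: "0 \<le> u" "x = a + of_real u"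
      by (auto simp: in_segment scaleR_conv_of_real algebra_simps)
    then show ?thesis by (auto simp: a_def)
  qed
  have "norm (f 0 (a + 1) - (\<Sum>i\<le>Suc 0. f i a * (a + 1 - a) ^ i / fact i))
      \<le> (norm s * norm (s + 1) * real (Suc n) powr (- Re s - 2)) * norm (a + 1 - a) ^ Suc (Suc 0) / fact (Suc 0)"
  proof (rule complex_Taylor[of "closed_segment a (a + 1)"])
    fix i x assume x: "x \<in> closed_segment a (a + 1)" and i: "i \<le> Suc 0"
    have "x \<notin> \<real>\<^sub>\<le>\<^sub>0" using seg[OF x] by (auto simp: complex_nonpos_Reals_iff)
    moreover have "i = 0 \<or> i = Suc 0" using i by auto
    ultimately show "(f i has_field_derivative f (Suc i) x) (at x within closed_segment a (a + 1))"
      by (auto simp: f_def algebra_simps intro!: derivative_eq_intros)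
  next
    fix x assume x: "x \<in> closed_segment a (a + 1)"
    have "norm (x powr (-s - 2)) = Re x powr (- Re s - 2)"
      using seg[OF x] by (subst norm_powr_real_powr) auto
    also have "\<dots> \<le> real (Suc n) powr (- Re s - 2)"
      using seg[OF x] s by (intro powr_mono2') auto
    finally show "norm (f (Suc (Suc 0)) x) \<le> norm s * norm (s + 1) * real (Suc n) powr (- Re s - 2)"
      by (simp add: f_def norm_mult mult_left_mono)
  qed auto
  also have "f 0 (a + 1) - (\<Sum>i\<le>Suc 0. f i a * (a + 1 - a) ^ i / fact i) = - abel_term n s"
    by (simp add: f_def abel_term_def a_def algebra_simps)
  finally show ?thesis by simp
qed

section \<open>Abel summation with linearly bounded partial sums\<close>

context
  fixes A :: "nat \<Rightarrow> real" and C :: real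
  assumes A: "\<And>n. \<bar>A n\<bar> \<le> C * real n"
begin

lemma abel_bound_nonneg: "C \<ge> 0"
  using order_trans[OF abs_ge_zero A[of 1]] by simp

lemma abel_sum_bound_local:
  assumes "x \<in> {s. Re s > 0}"
  shows "\<exists>d h. 0 < d \<and> summable h \<and>
    (\<forall>n. \<forall>y\<in>ball x d \<inter> {s. Re s > 0}. norm (of_real (A (Suc n)) * abel_term n y) \<le> h n)"
proof -
  define r where "r = Re x / 2"
  have r: "r > 0" "Re x = 2 * r" using assms by (auto simp: r_def)
  define K where "K = C * ((norm x + r) * (norm x + r + 1))"
  have K: "K \<ge> 0" using abel_bound_nonneg r by (simp add: K_def)
  have "norm (of_real (A (Suc n)) * abel_term n y) \<le> K * real (Suc n) powr (- r - 1)"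
    if y: "y \<in> ball x r" for n y
  proof -
    have n1: "norm y \<le> norm x + r" using y norm_triangle_ineq2[of y x] by (auto simp: dist_norm norm_minus_commute)
    have n2: "norm (y + 1) \<le> norm x + r + 1" using norm_triangle_ineq[of y 1] n1 by simp
    have re: "Re y \<ge> r" using y abs_Re_le_cmod[of "x - y"] r by (auto simp: dist_norm)
    have "norm (abel_term n y) \<le> norm y * norm (y + 1) * real (Suc n) powr (- Re y - 2)"
      using re r by (intro norm_abel_term_le) auto
    also have "\<dots> \<le> (norm x + r) * (norm x + r + 1) * real (Suc n) powr (- r - 2)"
      using n1 n2 re r by (intro mult_mono powr_mono) auto
    finally have "norm (of_real (A (Suc n)) * abel_term n y) \<le>
        (C * real (Suc n)) * ((norm x + r) * (norm x + r + 1) * real (Suc n) powr (- r - 2))"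
      unfolding norm_mult norm_of_real by (intro mult_mono A) (use abel_bound_nonneg in auto)
    also have "\<dots> = K * (real (Suc n) * real (Suc n) powr (- r - 2))" by (simp add: K_def mult_ac)
    also have "real (Suc n) * real (Suc n) powr (- r - 2) = real (Suc n) powr (- r - 1)"
    proof -
      have "1 + (- r - 2) = - r - 1" by simp
      then show ?thesis using powr_mult_base[of "real (Suc n)" "- r - 2"] by (simp only: of_nat_0_le_iff)
    qed
    finally show ?thesis .
  qed
  moreover have "summable (\<lambda>n. K * real (Suc n) powr (- r - 1))"
  proof -
    have "summable (\<lambda>n. real n powr (- r - 1))" using r by (subst summable_real_powr_iff) auto
    then have "summable (\<lambda>n. real (Suc n) powr (- r - 1))" by (subst summable_Suc_iff)
    then show ?thesis by (rule summable_mult)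
  qed
  ultimately show ?thesis using r by blast
qed

lemma abel_sum_sums: "Re s > 0 \<Longrightarrow> (\<lambda>n. of_real (A (Suc n)) * abel_term n s) sums abel_sum A s"
  and holomorphic_abel_sum: "abel_sum A holomorphic_on {s. Re s > 0}"
proof -
  have hol: "(\<lambda>s. of_real (A (Suc n)) * abel_term n s) holomorphic_on {s. Re s > 0}" for n
    unfolding abel_term_def by (intro holomorphic_intros) (auto simp del: of_nat_Suc)
  note * = series_holomorphic[OF open_halfspace_Re_gt hol abel_sum_bound_local]
  show "abel_sum A holomorphic_on {s. Re s > 0}" using *(2) unfolding abel_sum_def[abs_def] .
  show "(\<lambda>n. of_real (A (Suc n)) * abel_term n s) sums abel_sum A s" if "Re s > 0"
    using *(1)[of s] that unfolding abel_sum_def by (intro summable_sums) auto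
qed

text \<open>Summation by parts moves the difference from A to the powers; the boundary term vanishes
  because Re s > 1 and A is linearly bounded. Each difference of powers is s n^(-s - 1) plus
  \<open>abel_term\<close>, whose contribution is split off and the rest divided by s.\<close>

lemma abel_summation:
  assumes A0: "A 0 = 0" and s: "Re s > 1"
    and D: "(\<lambda>n. of_real (A (Suc n) - A n) * of_nat (Suc n) powr (-s)) sums D"
  shows "(\<lambda>n. of_real (A (Suc n)) * of_nat (Suc n) powr (-s - 1)) sums ((D - abel_sum A s) / s)"
proof -
  let ?p = "\<lambda>n. of_nat (Suc n) powr (-s) :: complex"
  have partial: "(\<Sum>n<N. of_real (A (Suc n)) * (?p n - ?p (Suc n))) =
      (\<Sum>n<N. of_real (A (Suc n) - A n) * ?p n) - of_real (A N) * ?p N" for N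
    by (induction N) (simp_all add: A0 algebra_simps del: of_nat_Suc)
  have "(\<lambda>N. of_real (A N) * ?p N) \<longlonglongrightarrow> 0"
  proof (rule Lim_null_comparison)
    show "\<forall>\<^sub>F N in sequentially. norm (of_real (A N) * ?p N) \<le> C * (real (Suc N) powr (1 - Re s))"
    proof (intro always_eventually allI)
      fix N
      have "norm (of_real (A N) * ?p N) = \<bar>A N\<bar> * real (Suc N) powr (- Re s)"
        by (simp add: norm_mult norm_of_nat_powr[OF zero_less_Suc] del: of_nat_Suc)
      also have "\<dots> \<le> (C * real (Suc N)) * real (Suc N) powr (- Re s)"
        using A[of N] abel_bound_nonneg mult_left_mono[of "real N" "real (Suc N)" C] by (intro mult_right_mono) auto
      also have "\<dots> = C * (real (Suc N) powr (1 - Re s))"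
        using powr_mult_base[of "real (Suc N)" "- Re s"] by simp
      finally show "norm (of_real (A N) * ?p N) \<le> C * (real (Suc N) powr (1 - Re s))" .
    qed
    have "(\<lambda>N. real (Suc N) powr (1 - Re s)) \<longlonglongrightarrow> 0" using s by real_asymp
    then show "(\<lambda>N. C * (real (Suc N) powr (1 - Re s))) \<longlonglongrightarrow> 0" by (rule tendsto_mult_right_zero)
  qed
  from tendsto_diff[OF D[unfolded sums_def] this]
  have "(\<lambda>n. of_real (A (Suc n)) * (?p n - ?p (Suc n))) sums D"
    unfolding sums_def partial by simp
  from sums_diff[OF this abel_sum_sums[of s]] s
  have "(\<lambda>n. of_real (A (Suc n)) * (?p n - ?p (Suc n)) - of_real (A (Suc n)) * abel_term n s) sums (D - abel_sum A s)"
    by simp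
  also have "(\<lambda>n. of_real (A (Suc n)) * (?p n - ?p (Suc n)) - of_real (A (Suc n)) * abel_term n s) =
      (\<lambda>n. (of_real (A (Suc n)) * of_nat (Suc n) powr (-s - 1)) * s)"
    by (simp add: abel_term_def algebra_simps del: of_nat_Suc)
  finally have "(\<lambda>n. (of_real (A (Suc n)) * of_nat (Suc n) powr (-s - 1)) * s / s) sums ((D - abel_sum A s) / s)"
    by (rule sums_divide)
  moreover have "s \<noteq> 0" using s by auto
  ultimately show ?thesis by simp
qed

end

text \<open>
  Abel summation of \<open>\<Sum> n powr (-s)\<close> shows that this is \<open>(s - 1) \<zeta>(s)\<close> for \<open>Re s > 1\<close>; the series
  itself converges for \<open>Re s > 0\<close>.
\<close>

definition xi :: "complex \<Rightarrow> complex" where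
  "xi s = - abel_sum real s"

lemma abs_real_le: "\<bar>real n\<bar> \<le> 1 * real n" by simp

lemma holomorphic_xi: "xi holomorphic_on {s. Re s > 0}"
  unfolding xi_def[abs_def] using holomorphic_abel_sum[where A = real, OF abs_real_le]
  by (intro holomorphic_intros) (auto intro: exI[of _ "1 :: complex"])

text \<open>For A n = n the increments are 1 and A n * n^(-s - 1) is n^(-s), so
  \<open>zeta s\<close> stands on both sides of Abel summation and the equation can be solved for
  it.\<close>

lemma xi_eq_zeta:
  assumes "Re s > 1"
  shows "xi s = (s - 1) * zeta s"
proof -
  have 1: "(\<lambda>n. of_real (real (Suc n) - real n) * of_nat (Suc n) powr (-s)) sums zeta s"
    using dirichlet_sums[OF abs_one_le assms] by simp
  have "of_real (real (Suc n)) * of_nat (Suc n) powr (-s - 1) = (of_nat (Suc n) powr (-s) :: complex)" for n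
    by (simp add: powr_diff del: of_nat_Suc)
  then have "(\<lambda>n. of_nat (Suc n) powr (-s)) sums ((zeta s - abel_sum real s) / s)"
    using abel_summation[where A = real, OF abs_real_le _ assms 1] by simp
  moreover have "(\<lambda>n. of_nat (Suc n) powr (-s)) sums zeta s"
    using dirichlet_sums[OF abs_one_le assms] by simp
  ultimately have "zeta s = (zeta s - abel_sum real s) / s" using sums_unique2 by blast
  moreover have "s \<noteq> 0" using assms by auto
  ultimately have "zeta s * s = zeta s - abel_sum real s" by (simp add: eq_divide_eq)
  then show ?thesis unfolding xi_def by (simp add: algebra_simps)
qed

text \<open>At s = 1 the series telescopes: n (1 / n - 1 / (n + 1) - 1 / n^2) = 1 / (n + 1) - 1 / n.
  This is the residue of zeta at its pole, found without a limit.\<close>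

lemma xi_1: "xi 1 = 1"
proof -
  have "of_real (real (Suc n)) * abel_term n 1 = 1 / of_nat (Suc (Suc n)) - 1 / (of_nat (Suc n) :: complex)" for n
  proof -
    have "of_nat (Suc n) \<noteq> (0 :: complex)" "of_nat (Suc (Suc n)) \<noteq> (0 :: complex)" by (simp_all del: of_nat_Suc)
    moreover have "x powr (-1) = 1 / x" "x powr (-2) = 1 / x\<^sup>2" if "x \<noteq> 0" for x :: complex
      using that by (simp_all add: powr_minus powr_numeral divide_inverse)
    ultimately have "abel_term n 1 = 1 / of_nat (Suc n) - 1 / of_nat (Suc (Suc n)) - 1 / (of_nat (Suc n))\<^sup>2"
      by (simp add: abel_term_def del: of_nat_Suc)
    moreover have "x * (1 / x - 1 / (x + 1) - 1 / x\<^sup>2) = 1 / (x + 1) - 1 / x" if "x \<noteq> 0" "x + 1 \<noteq> 0" for x :: complex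
    proof -
      have "x * (1 / x - 1 / (x + 1) - 1 / x\<^sup>2) = 1 - x / (x + 1) - 1 / x"
        using that by (simp add: right_diff_distrib power2_eq_square)
      also have "x / (x + 1) = 1 - 1 / (x + 1)"
        using that(2) diff_divide_distrib[of "x + 1" 1 "x + 1"] by simp
      finally show ?thesis by simp
    qed
    from this[of "of_nat (Suc n)"] have "of_nat (Suc n) * (1 / of_nat (Suc n) - 1 / of_nat (Suc (Suc n)) - 1 / (of_nat (Suc n))\<^sup>2)
       = 1 / of_nat (Suc (Suc n)) - 1 / (of_nat (Suc n) :: complex)"
      using \<open>of_nat (Suc n) \<noteq> (0 :: complex)\<close> \<open>of_nat (Suc (Suc n)) \<noteq> (0 :: complex)\<close> by (simp add: add.commute)
    ultimately show ?thesis by (simp del: of_nat_Suc)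
  qed
  moreover have "(\<lambda>n. 1 / of_nat (Suc (Suc n)) - 1 / (of_nat (Suc n) :: complex)) sums (0 - 1 / of_nat (Suc 0))"
    by (rule telescope_sums[OF LIMSEQ_Suc[OF lim_1_over_n]])
  ultimately have "(\<lambda>n. of_real (real (Suc n)) * abel_term n 1) sums (-1)" by simp
  then have "abel_sum real 1 = -1"
    unfolding abel_sum_def by (simp add: sums_iff)
  then show ?thesis by (simp add: xi_def)
qed

text \<open>Logarithmic derivative of (s - 1) zeta(s), in product form because division by
  \<open>xi s\<close> has to wait for nonvanishing.\<close>

lemma deriv_xi:
  assumes "Re s > 1"
  shows "deriv xi s = xi s * (1 / (s - 1) - mangoldt_series s)"
proof -
  have "(zeta has_field_derivative deriv zeta s) (at s)"
    using holomorphic_derivI[OF holomorphic_dirichlet[OF abs_one_le] open_halfspace_Re_gt] assms by auto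
  then have "((\<lambda>s. (s - 1) * zeta s) has_field_derivative (zeta s + (s - 1) * deriv zeta s)) (at s)"
    by (auto intro!: derivative_eq_intros)
  then have "(xi has_field_derivative (zeta s + (s - 1) * deriv zeta s)) (at s)"
    by (rule has_field_derivative_transform_within_open[OF _ open_halfspace_Re_gt[of 1]])
       (use assms xi_eq_zeta in auto)
  then have "deriv xi s = zeta s + (s - 1) * deriv zeta s" by (rule DERIV_imp_deriv)
  also have "\<dots> = xi s * (1 / (s - 1) - mangoldt_series s)"
  proof -
    have "a * z * (1 / a - l) = z + a * (- z * l)" if "a \<noteq> 0" for a z l :: complex
      using that by (simp add: right_diff_distrib)
    moreover have "s - 1 \<noteq> 0" using assms by auto
    ultimately show ?thesis unfolding xi_eq_zeta[OF assms] deriv_zeta[OF assms] by metis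
  qed
  finally show ?thesis .
qed

section \<open>Orders of zeros and the 3-4-1 argument\<close>

text \<open>Writing f w = (w - p)^m g w with g nonzero near p gives e f' / f = m + e g' / g. The
  approach is from the right, where the Dirichlet series converge.\<close>

lemma tendsto_log_deriv_order:
  assumes f: "f holomorphic_on S" and S: "open S" "Topological_Spaces.connected S" "p \<in> S" and nz: "\<exists>z\<in>S. f z \<noteq> 0"
  obtains m :: nat where "m = 0 \<longleftrightarrow> f p \<noteq> 0"
    and "((\<lambda>e. of_real e * (deriv f (p + of_real e) / f (p + of_real e))) \<longlongrightarrow> of_nat m) (at_right (0 :: real))"
    and "\<forall>\<^sub>F e in at_right 0. f (p + of_real e) \<noteq> 0"
proof -
  obtain g r m where r: "r > 0" and g: "g holomorphic_on ball p r" and m: "m = 0 \<longleftrightarrow> f p \<noteq> 0"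
    and fg: "\<And>w. w \<in> ball p r \<Longrightarrow> f w = (w - p) ^ m * g w" and g0: "\<And>w. w \<in> ball p r \<Longrightarrow> g w \<noteq> 0"
  proof (cases "f p = 0")
    case True
    have "\<not> f constant_on S"
      using nz True S(3) unfolding constant_on_def by metis
    then obtain g r m where "0 < m" "0 < r" "g holomorphic_on ball p r"
      "\<And>w. w \<in> ball p r \<Longrightarrow> f w = (w - p) ^ m * g w" "\<And>w. w \<in> ball p r \<Longrightarrow> g w \<noteq> 0"
      using holomorphic_factor_zero_nonconstant[OF f S True] by metis
    then show thesis using that[of r g m] True by auto
  next
    case False
    have "open {w \<in> S. f w \<in> - {0}}"
      using continuous_open_preimage[OF holomorphic_on_imp_continuous_on[OF f] S(1), of "- {0}"]
      by (simp add: Int_def vimage_def open_Compl)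
    then obtain r where r: "r > 0" "ball p r \<subseteq> {w \<in> S. f w \<in> - {0}}"
      using False S(3) unfolding open_contains_ball by blast
    then have "f holomorphic_on ball p r" by (intro holomorphic_on_subset[OF f]) auto
    moreover have "f w \<noteq> 0" if "w \<in> ball p r" for w using r that by auto
    ultimately show thesis using r False by (intro that[of r f 0]) simp_all
  qed
  have ev: "\<forall>\<^sub>F e in at_right (0 :: real). 0 < e \<and> e < r"
    using r by (intro eventually_conj eventually_at_right_less eventually_at_rightI[of 0 r]) auto
  show thesis
  proof (rule that[OF m])
    show "\<forall>\<^sub>F e in at_right 0. f (p + of_real e) \<noteq> 0"
      using ev by eventually_elim (use fg g0 in \<open>auto simp: dist_norm\<close>)
    have lim: "((\<lambda>e. p + complex_of_real e) \<longlongrightarrow> p) (at_right 0)"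
      by (auto intro!: tendsto_eq_intros)
    have "isCont (\<lambda>w. deriv g w / g w) p"
      using r g0[of p] holomorphic_on_imp_continuous_on[OF g] holomorphic_on_imp_continuous_on[OF holomorphic_deriv[OF g open_ball]]
      by (intro continuous_intros) (auto simp: continuous_on_eq_continuous_at)
    from isCont_tendsto_compose[OF this lim]
    have "((\<lambda>e. of_nat m + of_real e * (deriv g (p + of_real e) / g (p + of_real e))) \<longlongrightarrow> of_nat m + of_real 0 * (deriv g p / g p)) (at_right 0)"
      by (intro tendsto_add tendsto_mult tendsto_const tendsto_of_real tendsto_ident_at)
    moreover have "\<forall>\<^sub>F e in at_right (0 :: real). of_nat m + of_real e * (deriv g (p + of_real e) / g (p + of_real e)) =
        of_real e * (deriv f (p + of_real e) / f (p + of_real e))"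
      using ev
    proof eventually_elim
      case (elim e)
      define w where "w = p + complex_of_real e"
      have w: "w \<in> ball p r" "w - p \<noteq> 0" "w - p = of_real e" using elim by (auto simp: w_def dist_norm)
      have "((\<lambda>w. (w - p) ^ m * g w) has_field_derivative of_nat m * (w - p) ^ (m - 1) * g w + (w - p) ^ m * deriv g w) (at w)"
        using holomorphic_derivI[OF g open_ball w(1)] by (auto intro!: derivative_eq_intros)
      then have "(f has_field_derivative of_nat m * (w - p) ^ (m - 1) * g w + (w - p) ^ m * deriv g w) (at w)"
        by (rule has_field_derivative_transform_within_open[OF _ open_ball w(1)]) (use fg in auto)
      then have D: "deriv f w = of_nat m * (w - p) ^ (m - 1) * g w + (w - p) ^ m * deriv g w"
        by (rule DERIV_imp_deriv)
      have "u * (of_nat m * u ^ (m - 1) * G + u ^ m * G') = (of_nat m * G + u * G') * u ^ m" for u G G' :: complex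
        by (cases m) (simp_all add: algebra_simps)
      then have E: "(w - p) * deriv f w = (of_nat m * g w + (w - p) * deriv g w) * (w - p) ^ m"
        unfolding D .
      have "(a * G + b) * c / (c * G) = a + b / G" if "c \<noteq> 0" "G \<noteq> 0" for a b c G :: complex
        using that by (simp add: field_simps)
      from this[of "(w - p) ^ m" "g w" "of_nat m" "(w - p) * deriv g w"]
      have "(w - p) * (deriv f w / f w) = of_nat m + (w - p) * (deriv g w / g w)"
        unfolding times_divide_eq_right E fg[OF w(1)] using g0[OF w(1)] w(2) by simp
      then show ?case using w(3) by (simp add: w_def)
    qed
    ultimately show "((\<lambda>e. of_real e * (deriv f (p + of_real e) / f (p + of_real e))) \<longlongrightarrow> of_nat m) (at_right 0)"
      by (simp add: tendsto_cong)
  qed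
qed

text \<open>The Mangoldt series is 1 / (s - 1) - xi' / xi. After scaling by e, the first term
  survives only at p = 1 and the second yields the order of the zero.\<close>

lemma tendsto_mangoldt_series_order:
  assumes p: "Re p \<ge> 1"
  obtains m :: nat where "m = 0 \<longleftrightarrow> xi p \<noteq> 0"
    and "((\<lambda>e. of_real e * mangoldt_series (p + of_real e)) \<longlongrightarrow> (if p = 1 then 1 else 0) - of_nat m) (at_right (0 :: real))"
proof -
  have conn: "Topological_Spaces.connected {s. Re s > 0}" by (intro convex_connected convex_halfspace_Re_gt)
  have nz: "\<exists>z\<in>{s. Re s > 0}. xi z \<noteq> 0" using xi_1 by (intro bexI[of _ 1]) auto
  have pin: "p \<in> {s. Re s > 0}" using p by simp
  obtain m :: nat where m: "m = 0 \<longleftrightarrow> xi p \<noteq> 0"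
    "((\<lambda>e. of_real e * (deriv xi (p + of_real e) / xi (p + of_real e))) \<longlongrightarrow> of_nat m) (at_right (0 :: real))"
    "\<forall>\<^sub>F e in at_right 0. xi (p + of_real e) \<noteq> 0"
    by (rule tendsto_log_deriv_order[OF holomorphic_xi open_halfspace_Re_gt conn pin nz])
  have ev: "\<forall>\<^sub>F e in at_right (0 :: real). 0 < e" by (rule eventually_at_right_less)
  have "((\<lambda>e. of_real e / (p + of_real e - 1)) \<longlongrightarrow> (if p = 1 then 1 else 0)) (at_right (0 :: real))"
  proof (cases "p = 1")
    case True
    have "\<forall>\<^sub>F e in at_right (0 :: real). of_real e / (p + of_real e - 1) = 1"
      using ev by eventually_elim (use True in auto)
    then show ?thesis using True by (simp add: tendsto_cong)
  next
    case False
    then show ?thesis by (auto intro!: tendsto_eq_intros)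
  qed
  from tendsto_diff[OF this m(2)]
  have "((\<lambda>e. of_real e / (p + of_real e - 1) - of_real e * (deriv xi (p + of_real e) / xi (p + of_real e)))
      \<longlongrightarrow> (if p = 1 then 1 else 0) - of_nat m) (at_right (0 :: real))" .
  moreover have "\<forall>\<^sub>F e in at_right (0 :: real). of_real e / (p + of_real e - 1) - of_real e * (deriv xi (p + of_real e) / xi (p + of_real e))
      = of_real e * mangoldt_series (p + of_real e)"
    using ev m(3)
  proof eventually_elim
    case (elim e)
    then have "Re (p + of_real e) > 1" using p by simp
    from deriv_xi[OF this] have D: "deriv xi (p + of_real e) / xi (p + of_real e) = 1 / (p + of_real e - 1) - mangoldt_series (p + of_real e)"
      using elim by simp
    show ?case unfolding D by (simp add: right_diff_distrib)
  qed
  ultimately show thesis using m(1) that[of m] by (simp add: tendsto_cong)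
qed

text \<open>The coefficients are nonnegative, and 3 + 4 cos x + cos (2 x) = 2 (1 + cos x)^2.\<close>

lemma mangoldt_series_3_4_1:
  assumes "\<sigma> > 1"
  shows "0 \<le> Re (3 * mangoldt_series (of_real \<sigma>) + 4 * mangoldt_series (of_real \<sigma> + \<i> * of_real t)
    + mangoldt_series (of_real \<sigma> + \<i> * of_real (2 * t)))"
proof -
  define w where "w = (\<lambda>n. mangoldt (Suc n) * real (Suc n) powr (-\<sigma>))"
  have re: "Re (of_nat (Suc n) powr (- (of_real \<sigma> + \<i> * of_real u))) = real (Suc n) powr (-\<sigma>) * cos (u * ln (Suc n))" for n u
    by (simp add: powr_def Re_exp Ln_of_nat del: of_nat_Suc)
  have sums: "(\<lambda>n. w n * cos (u * ln (Suc n))) sums Re (mangoldt_series (of_real \<sigma> + \<i> * of_real u))" for u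
  proof -
    have "Re (of_real \<sigma> + \<i> * of_real u) > 1" using assms by simp
    from sums_Re[OF dirichlet_sums[OF abs_mangoldt_le this]]
    moreover have "Re (of_real a * z) = a * Re z" for a z by simp
    ultimately show ?thesis by (simp only: re w_def mult.assoc)
  qed
  have "(\<lambda>n. 3 * (w n * cos (0 * ln (Suc n))) + 4 * (w n * cos (t * ln (Suc n))) + w n * cos (2 * t * ln (Suc n))) sums
     (3 * Re (mangoldt_series (of_real \<sigma> + \<i> * of_real 0)) + 4 * Re (mangoldt_series (of_real \<sigma> + \<i> * of_real t)) +
      Re (mangoldt_series (of_real \<sigma> + \<i> * of_real (2 * t))))"
    by (intro sums_add sums_mult sums)
  then have "0 \<le> 3 * Re (mangoldt_series (of_real \<sigma> + \<i> * of_real 0)) + 4 * Re (mangoldt_series (of_real \<sigma> + \<i> * of_real t)) +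
      Re (mangoldt_series (of_real \<sigma> + \<i> * of_real (2 * t)))"
  proof (rule sums_le[OF _ sums_zero, rotated])
    fix n
    define c where "c = cos (t * ln (real (Suc n)))"
    have c2: "cos (2 * t * ln (real (Suc n))) = 2 * c\<^sup>2 - 1"
      using cos_double_cos[of "t * ln (real (Suc n))"] unfolding c_def by (simp only: mult.assoc)
    then have "3 * (w n * cos (0 * ln (Suc n))) + 4 * (w n * cos (t * ln (Suc n))) + w n * cos (2 * t * ln (Suc n))
      = 3 * w n + 4 * (w n * c) + w n * (2 * c\<^sup>2 - 1)"
      by (simp only: c2 c_def mult_zero_left cos_zero mult_1_right)
    also have "\<dots> = w n * (2 * (1 + c)\<^sup>2)"
      by (simp add: algebra_simps power2_eq_square)
    also have "\<dots> \<ge> 0" by (simp add: w_def mangoldt_nonneg)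
    finally show "0 \<le> 3 * (w n * cos (0 * ln (Suc n))) + 4 * (w n * cos (t * ln (Suc n))) + w n * cos (2 * t * ln (Suc n))" .
  qed
  then show ?thesis by simp
qed

text \<open>
  For a zero of order \<open>m\<close> at \<open>1 + i t\<close>, multiplying the 3-4-1 inequality at \<open>\<sigma> = 1 + e\<close> by \<open>e\<close> and letting
  \<open>e \<rightarrow> 0\<close> gives \<open>0 \<le> 3 - 4 m\<close>. The same limit also excludes zeros with \<open>Re s > 1\<close>.
\<close>

theorem xi_nonzero:
  assumes "Re s \<ge> 1"
  shows "xi s \<noteq> 0"
proof
  assume "xi s = 0"
  define \<sigma> t where "\<sigma> = Re s" and "t = Im s"
  have s: "s = of_real \<sigma> + \<i> * of_real t" by (simp add: \<sigma>_def t_def complex_eq_iff)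
  have \<sigma>: "\<sigma> \<ge> 1" using assms by (simp add: \<sigma>_def)
  have "s \<noteq> 1" using \<open>xi s = 0\<close> xi_1 by auto
  let ?p = "\<lambda>u. complex_of_real \<sigma> + \<i> * of_real u"
  let ?\<delta> = "\<lambda>u. if ?p u = 1 then 1 else 0 :: real"
  have "\<exists>m :: nat. (m = 0 \<longleftrightarrow> xi (?p u) \<noteq> 0) \<and>
      ((\<lambda>e. e * Re (mangoldt_series (of_real (\<sigma> + e) + \<i> * of_real u))) \<longlongrightarrow> ?\<delta> u - real m) (at_right 0)" for u
  proof -
    have "Re (?p u) \<ge> 1" using \<sigma> by simp
    then obtain m :: nat where m: "m = 0 \<longleftrightarrow> xi (?p u) \<noteq> 0"
      "((\<lambda>e. of_real e * mangoldt_series (?p u + of_real e)) \<longlongrightarrow> (if ?p u = 1 then 1 else 0) - of_nat m) (at_right (0 :: real))"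
      by (rule tendsto_mangoldt_series_order)
    from tendsto_Re[OF m(2)] have "((\<lambda>e. e * Re (mangoldt_series (of_real (\<sigma> + e) + \<i> * of_real u))) \<longlongrightarrow> ?\<delta> u - real m) (at_right 0)"
      by (simp add: algebra_simps if_distrib[of Re] cong: if_cong)
    then show ?thesis using m(1) by (intro exI conjI)
  qed
  note ord = this
  obtain m0 :: nat where m0: "((\<lambda>e. e * Re (mangoldt_series (of_real (\<sigma> + e) + \<i> * of_real 0))) \<longlongrightarrow> ?\<delta> 0 - real m0) (at_right 0)"
    using ord[of 0] by (elim exE conjE)
  obtain m1 :: nat where m1: "m1 = 0 \<longleftrightarrow> xi (?p t) \<noteq> 0"
    "((\<lambda>e. e * Re (mangoldt_series (of_real (\<sigma> + e) + \<i> * of_real t))) \<longlongrightarrow> ?\<delta> t - real m1) (at_right 0)"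
    using ord[of t] by (elim exE conjE)
  obtain m2 :: nat where m2: "((\<lambda>e. e * Re (mangoldt_series (of_real (\<sigma> + e) + \<i> * of_real (2 * t)))) \<longlongrightarrow> ?\<delta> (2 * t) - real m2) (at_right 0)"
    using ord[of "2 * t"] by (elim exE conjE)
  let ?L = "\<lambda>e u. Re (mangoldt_series (of_real (\<sigma> + e) + \<i> * of_real u))"
  have "((\<lambda>e. 3 * (e * ?L e 0) + 4 * (e * ?L e t) + e * ?L e (2 * t)) \<longlongrightarrow>
      3 * (?\<delta> 0 - real m0) + 4 * (?\<delta> t - real m1) + (?\<delta> (2 * t) - real m2)) (at_right 0)"
    by (intro tendsto_intros m0 m1(2) m2)
  moreover have "\<forall>\<^sub>F e in at_right 0. 0 \<le> 3 * (e * ?L e 0) + 4 * (e * ?L e t) + e * ?L e (2 * t)"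
    using eventually_at_right_less[of 0]
  proof eventually_elim
    case (elim e)
    have "0 \<le> e * Re (3 * mangoldt_series (of_real (\<sigma> + e)) + 4 * mangoldt_series (of_real (\<sigma> + e) + \<i> * of_real t)
        + mangoldt_series (of_real (\<sigma> + e) + \<i> * of_real (2 * t)))"
      using elim \<sigma> mangoldt_series_3_4_1[of "\<sigma> + e" t] by (intro mult_nonneg_nonneg) auto
    also have "\<dots> = 3 * (e * ?L e 0) + 4 * (e * ?L e t) + e * ?L e (2 * t)"
      by (simp add: algebra_simps)
    finally show ?case .
  qed
  ultimately have "0 \<le> 3 * (?\<delta> 0 - real m0) + 4 * (?\<delta> t - real m1) + (?\<delta> (2 * t) - real m2)"
    by (intro tendsto_lowerbound) (auto simp: trivial_limit_at_right_real)
  moreover have "?\<delta> t = 0" using \<open>s \<noteq> 1\<close> s by simp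
  \<comment> \<open>The pole at 1 can only be met at height 0: height 2 t would require t = 0 and
    \<sigma> = 1, that is s = 1.\<close>
  moreover have "3 * ?\<delta> 0 + ?\<delta> (2 * t) \<le> 3"
    using \<open>s \<noteq> 1\<close> s by (auto simp: complex_eq_iff)
  moreover have "m1 \<ge> 1" using m1(1) \<open>xi s = 0\<close> s by (simp add: Suc_le_eq)
  then have "real m1 \<ge> 1" by simp
  moreover have "real m0 \<ge> 0" "real m2 \<ge> 0" by simp_all
  ultimately show False by argo
qed

text \<open>With z = s - 1, the series of (psi n - n) / n^2 * n^(-z) is the Abel-summed Mangoldt
  series minus \<open>zeta s\<close>. Expressed through \<open>xi\<close>, both parts have a pole at
  s = 1, and the poles cancel because \<open>xi 1 = 1\<close>.\<close>

theorem summable_psi_error: "summable (\<lambda>n. (psi n - real n) / (real n)\<^sup>2)"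
proof -
  have psi_bd: "\<bar>psi n\<bar> \<le> 4 * real n" for n using psi_le[of n] psi_nonneg[of n] by simp
  define W where "W = {s. Re s > 0} \<inter> xi -` (- {0})"
  have "open W"
    unfolding W_def using holomorphic_on_imp_continuous_on[OF holomorphic_xi] open_halfspace_Re_gt
    by (rule continuous_open_preimage) auto
  have W: "s \<in> W" if "Re s \<ge> 1" for s using that xi_nonzero[OF that] by (auto simp: W_def)
  have W': "Re s > 0" "xi s \<noteq> 0" "s \<noteq> 0" if "s \<in> W" for s using that by (auto simp: W_def)
  define g where "g = (\<lambda>s. 1 / s - xi s)"
  \<comment> \<open>Here \<open>q\<close> is (1 / s - xi s) / (s - 1) with its removable singularity
    filled in; it collects the two polar parts, while the remainder of \<open>H\<close> is
    holomorphic on \<open>W\<close>.\<close>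
  define q where "q = (\<lambda>s. if s = 1 then deriv g 1 else (g s - g 1) / (s - 1))"
  define H where "H = (\<lambda>s. q s - (deriv xi s / xi s + abel_sum psi s) / s)"
  have xiW: "xi holomorphic_on W" by (rule holomorphic_on_subset[OF holomorphic_xi]) (auto simp: W_def)
  have "g holomorphic_on W"
    unfolding g_def using W' by (intro holomorphic_intros xiW) auto
  then have "q holomorphic_on W"
    unfolding q_def using \<open>open W\<close> W[of 1] by (intro pole_lemma) (auto simp: interior_open)
  moreover have "abel_sum psi holomorphic_on W"
    by (rule holomorphic_on_subset[OF holomorphic_abel_sum[where A = psi, OF psi_bd]]) (auto simp: W_def)
  ultimately have "H holomorphic_on W"
    unfolding H_def using W' \<open>open W\<close> by (intro holomorphic_intros xiW) auto
  define U where "U = (\<lambda>z. z + 1) -` W"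
  define c where "c = (\<lambda>n. complex_of_real ((psi (Suc n) - real (Suc n)) / (real (Suc n))\<^sup>2))"
  have "c sums H (0 + 1)"
  \<comment> \<open>The constant 5 is the 4 of \<open>psi_le\<close> plus 1 for the subtracted
    n.\<close>
  proof (rule newman_dirichlet_series[where G = "\<lambda>z. H (z + 1)" and U = U and C = 5])
    fix n
    have "\<bar>psi (Suc n) - real (Suc n)\<bar> \<le> 5 * real (Suc n)" using psi_bd[of "Suc n"] abs_triangle_ineq4[of "psi (Suc n)" "real (Suc n)"] by simp
    then have "\<bar>psi (Suc n) - real (Suc n)\<bar> / (real (Suc n))\<^sup>2 \<le> 5 * real (Suc n) / (real (Suc n))\<^sup>2"
      by (intro divide_right_mono) auto
    then show "norm (c n) \<le> 5 / real (Suc n)"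
      unfolding c_def norm_of_real by (simp add: power2_eq_square del: of_nat_Suc)
  next
    show "open U" unfolding U_def using \<open>open W\<close> by (intro open_vimage continuous_intros)
    show "{z. 0 \<le> Re z} \<subseteq> U" using W by (auto simp: U_def)
    have "H \<circ> (\<lambda>z. z + 1) holomorphic_on U"
      by (intro holomorphic_on_compose_gen[OF _ \<open>H holomorphic_on W\<close>] holomorphic_intros) (auto simp: U_def)
    then show "(\<lambda>z. H (z + 1)) holomorphic_on U" by (simp add: o_def)
  next
    fix z assume z: "Re z > 0"
    define s where "s = z + 1"
    have s: "Re s > 1" "s \<noteq> 1" "s \<noteq> 0" using z by (auto simp: s_def complex_eq_iff)
    have "psi (Suc n) - psi n = mangoldt (Suc n)" for n by (simp add: psi_def)
    then have "(\<lambda>n. of_real (psi (Suc n) - psi n) * of_nat (Suc n) powr (-s)) sums mangoldt_series s"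
      using dirichlet_sums[OF abs_mangoldt_le s(1)] by (simp only:)
    from abel_summation[where A = psi, OF psi_bd _ s(1) this]
    have "(\<lambda>n. of_real (psi (Suc n)) * of_nat (Suc n) powr (-s - 1)) sums ((mangoldt_series s - abel_sum psi s) / s)"
      by (simp add: psi_def)
    from sums_diff[OF this dirichlet_sums[OF abs_one_le s(1)]]
    have "(\<lambda>n. of_real (psi (Suc n)) * of_nat (Suc n) powr (-s - 1) - of_nat (Suc n) powr (-s)) sums
        ((mangoldt_series s - abel_sum psi s) / s - zeta s)"
      by (simp del: of_nat_Suc)
    also have "(mangoldt_series s - abel_sum psi s) / s - zeta s = H s"
    proof -
      have xi0: "xi s \<noteq> 0" using xi_nonzero s(1) by simp
      have "g 1 = 0" by (simp add: g_def xi_1)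
      have 1: "mangoldt_series s = 1 / (s - 1) - deriv xi s / xi s"
        using deriv_xi[OF s(1)] xi0 by simp
      have 2: "zeta s = xi s / (s - 1)" using xi_eq_zeta[OF s(1)] s by simp
      have "(1 / (s - 1) - d - E) / s - x / (s - 1) = (1 / s - x) / (s - 1) - (d + E) / s" for d E x
        using s by (simp add: divide_simps) (simp add: algebra_simps)
      then show ?thesis unfolding 1 2 H_def q_def using s \<open>g 1 = 0\<close> by (simp add: g_def)
    qed
    also have "(\<lambda>n. of_real (psi (Suc n)) * of_nat (Suc n) powr (-s - 1) - of_nat (Suc n) powr (-s)) =
        (\<lambda>n. c n * of_nat (Suc n) powr (-z))"
    proof
      fix n
      define x where "x = complex_of_nat (Suc n)"
      have x: "x \<noteq> 0" by (simp add: x_def del: of_nat_Suc)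
      have e1: "x powr (-s) = x powr (-z) / x"
      proof -
        have "-s = -z - 1" by (simp add: s_def)
        then show ?thesis using x by (simp only: powr_diff) simp
      qed
      have e2: "x powr (-s - 1) = x powr (-s) / x" using x by (simp add: powr_diff)
      have e3: "c n = (of_real (psi (Suc n)) - x) / x\<^sup>2" by (simp add: c_def x_def)
      show "of_real (psi (Suc n)) * of_nat (Suc n) powr (-s - 1) - of_nat (Suc n) powr (-s) = c n * of_nat (Suc n) powr (-z)"
        unfolding x_def[symmetric] e2 e1 e3 using x by (simp add: field_simps power2_eq_square)
    qed
    finally show "(\<lambda>n. c n * of_nat (Suc n) powr (-z)) sums H (z + 1)" by (simp add: s_def)
  qed
  then have "summable c" by (rule sums_summable)
  from summable_Re[OF this] have "summable (\<lambda>n. (psi (Suc n) - real (Suc n)) / (real (Suc n))\<^sup>2)"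
    unfolding c_def by (simp only: Re_complex_of_real)
  then show ?thesis by (subst (asm) summable_Suc_iff)
qed

section \<open>Mediated digraphs\<close>

lemma finite_in_nbhd:
  assumes "pair_digraph D"
  shows "finite (in_nbhd D x)" "in_nbhd D x \<subseteq> pverts D - {x}"
proof -
  interpret pair_digraph D by fact
  have "in_nbhd D x \<subseteq> fst ` parcs D" by (force simp: in_nbhd_def)
  then show "finite (in_nbhd D x)" using pair_finite_arcs finite_subset by blast
  show "in_nbhd D x \<subseteq> pverts D - {x}"
    using wellformed' pair_no_loops by (fastforce simp: in_nbhd_def)
qed

lemma card_in_nbhd_le_max_in_degree:
  assumes "pair_digraph D" "x \<in> pverts D"
  shows "card (in_nbhd D x) \<le> max_in_degree D"
proof -
  interpret pair_digraph D by fact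
  show ?thesis unfolding max_in_degree_def using assms(2) pair_finite_verts by (intro Max_ge) auto
qed

lemma card_off_diagonal:
  assumes "finite A"
  shows "card (A \<times> A - Id) = card A * (card A - 1)"
proof -
  have "card (A \<times> A - Id_on A) = card (A \<times> A) - card (Id_on A)"
    using assms by (intro card_Diff_subset finite_subset[OF Id_on_subset_Times]) (auto simp: Id_on_def)
  moreover have "card (Id_on A) = card A"
  proof -
    have "Id_on A = (\<lambda>x. (x, x)) ` A" by auto
    then show ?thesis by (simp add: card_image inj_on_def)
  qed
  moreover have "A \<times> A - Id = A \<times> A - Id_on A" by auto
  ultimately show ?thesis by (simp add: card_cartesian_product diff_mult_distrib2)
qed

lemma mediated_card_le:
  assumes "mediated D"
  shows "card (pverts D) - 1 \<le> max_in_degree D * (max_in_degree D + 1)"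
proof (cases "pverts D = {}")
  case False
  have D: "pair_digraph D" using assms by (simp add: mediated_def)
  interpret pair_digraph D by fact
  let ?V = "pverts D" and ?d = "max_in_degree D" and ?N = "closed_in_nbhd D"
  have fin: "finite (?N z)" for z using finite_in_nbhd[OF D] by (simp add: closed_in_nbhd_def)
  have "?V \<times> ?V - Id \<subseteq> (\<Union>z\<in>?V. ?N z \<times> ?N z - Id)"
    using assms unfolding mediated_def by blast
  then have "card (?V \<times> ?V - Id) \<le> card (\<Union>z\<in>?V. ?N z \<times> ?N z - Id)"
    using fin pair_finite_verts by (intro card_mono) auto
  also have "\<dots> \<le> (\<Sum>z\<in>?V. card (?N z \<times> ?N z - Id))"
    by (rule card_UN_le[OF pair_finite_verts])
  also have "\<dots> \<le> (\<Sum>z\<in>?V. (?d + 1) * ?d)"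
  proof (rule sum_mono)
    fix z assume z: "z \<in> ?V"
    have "card (?N z) \<le> ?d + 1"
      using card_in_nbhd_le_max_in_degree[OF D z] card_insert_le_m1[of "Suc ?d" "in_nbhd D z" z]
      by (simp add: closed_in_nbhd_def)
    then show "card (?N z \<times> ?N z - Id) \<le> (?d + 1) * ?d"
      unfolding card_off_diagonal[OF fin] by (intro mult_le_mono) auto
  qed
  also have "\<dots> = card ?V * (?d * (?d + 1))" by simp
  finally have "card ?V * (card ?V - 1) \<le> card ?V * (?d * (?d + 1))"
    by (simp add: card_off_diagonal[OF pair_finite_verts])
  moreover have "card ?V > 0" using False pair_finite_verts by (simp add: card_gt_0_iff)
  ultimately show ?thesis by simp
qed simp

text \<open>Completing the square: n - 1 <= d (d + 1) is the same as 4 n - 3 <= (2 d + 1)^2, so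
  \<open>f_bound n\<close> is the least natural number d satisfying the counting bound.\<close>

lemma f_bound_le_mediation_number:
  assumes "n \<ge> 1"
  shows "f_bound n \<le> int (mediation_number n)"
proof -
  obtain D :: "nat pair_pre_digraph" where D: "mediated D" "card (pverts D) = n" "max_in_degree D = mediation_number n"
    by (rule mediation_number_attained)
  let ?d = "mediation_number n"
  have "n \<le> ?d * (?d + 1) + 1" using mediated_card_le[OF D(1)] D assms by simp
  then have "real n \<le> real (?d * (?d + 1) + 1)" by (rule of_nat_mono)
  then have "4 * real n - 3 \<le> (2 * real ?d + 1)\<^sup>2"
    by (simp add: power2_eq_square algebra_simps)
  then have "sqrt (4 * real n - 3) \<le> 2 * real ?d + 1"
    by (intro real_le_lsqrt) auto
  then show ?thesis unfolding f_bound_def by (simp add: ceiling_le_iff)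
qed

text \<open>\<open>f_bound 1\<close> is 0, so the exact equation at n = 1 forces this value.\<close>

lemma mediation_number_one: "mediation_number 1 = 0"
proof -
  obtain D :: "nat pair_pre_digraph" where D: "mediated D" "card (pverts D) = 1" "max_in_degree D = mediation_number 1"
    by (rule mediation_number_attained)
  then obtain v where v: "pverts D = {v}" by (auto simp: card_1_singleton_iff)
  have "in_nbhd D v = {}" using finite_in_nbhd(2)[of D v] D(1) v by (auto simp: mediated_def)
  then show ?thesis using D(3) by (simp add: max_in_degree_def v)
qed

section \<open>Upper bound from lines and parabolas over a prime field\<close>

lemma dvd_mod_diff: "(p :: int) dvd m mod p - m"
  by (metis mod_eq_dvd_iff mod_mod_trivial)

text \<open>The difference of the values at two roots x and x0 factors as (x - x0) (x + x0 - a), and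
  a prime divides one of the factors.\<close>

lemma card_quadratic_roots_le:
  fixes a b :: int and p :: nat
  assumes p: "prime p"
  shows "card {x. x < p \<and> int p dvd (int x)\<^sup>2 - a * int x - b} \<le> 2"
proof (cases "{x. x < p \<and> int p dvd (int x)\<^sup>2 - a * int x - b} = {}")
  case False
  then obtain x0 where x0: "x0 < p" "int p dvd (int x0)\<^sup>2 - a * int x0 - b" by blast
  have "{x. x < p \<and> int p dvd (int x)\<^sup>2 - a * int x - b} \<subseteq> {x0, nat ((a - int x0) mod int p)}"
  proof
    fix x assume "x \<in> {x. x < p \<and> int p dvd (int x)\<^sup>2 - a * int x - b}"
    then have x: "x < p" "int p dvd (int x)\<^sup>2 - a * int x - b" by auto
    have "int p dvd ((int x)\<^sup>2 - a * int x - b) - ((int x0)\<^sup>2 - a * int x0 - b)"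
      using x(2) x0(2) by (rule dvd_diff)
    also have "\<dots> = (int x - int x0) * (int x + int x0 - a)"
      by (simp add: power2_eq_square algebra_simps)
    finally have "int p dvd int x - int x0 \<or> int p dvd int x + int x0 - a"
      using p by (simp add: prime_dvd_mult_iff)
    then show "x \<in> {x0, nat ((a - int x0) mod int p)}"
    proof
      assume "int p dvd int x - int x0"
      then have "int x mod int p = int x0 mod int p" by (simp add: mod_eq_dvd_iff)
      then show ?thesis using x x0 by simp
    next
      assume "int p dvd int x + int x0 - a"
      then have "int x mod int p = (a - int x0) mod int p" by (simp add: mod_eq_dvd_iff algebra_simps)
      then have "int x = (a - int x0) mod int p" using x by simp
      then show ?thesis by (metis insertCI nat_int)
    qed
  qed
  then have "card {x. x < p \<and> int p dvd (int x)\<^sup>2 - a * int x - b} \<le> card {x0, nat ((a - int x0) mod int p)}"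
    by (intro card_mono) auto
  also have "\<dots> \<le> 2" by (simp add: card_insert_le_m1)
  finally show ?thesis .
qed (simp only: card.empty)

lemma card_le_by_inj:
  assumes "inj_on f A" "f ` A \<subseteq> B" "finite B" "card B \<le> k"
  shows "card A \<le> k"
  using card_inj_on_le[OF assms(1-3)] assms(4) by linarith

text \<open>
  The \<open>q\<^sup>2\<close> points of the affine plane over the prime field of order \<open>q\<close> carry the \<open>q\<^sup>2\<close>
  non-vertical lines: the point \<open>(a, b)\<close> mediates the line of slope \<open>a\<close> through it. Every further
  vertex \<open>q\<^sup>2 + j q + x\<close> is a twin of the point \<open>(x, x\<^sup>2 + j)\<close>, so a non-vertical line gains at most
  two vertices for each parabola \<open>j\<close>. The first \<open>q\<close> of these further vertices mediate the vertical lines.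
\<close>

context
  fixes q :: nat
begin

definition point :: "nat \<Rightarrow> nat \<times> nat" where
  "point v = (if v < q * q then (v div q, v mod q)
     else ((v - q * q) mod q, (((v - q * q) mod q)\<^sup>2 + (v - q * q) div q) mod q))"

text \<open>For q > 0 and v >= q * q + q the block is empty, as first coordinates stay below q; such
  a vertex takes on no line.\<close>

definition block :: "nat \<Rightarrow> nat set" where
  "block v = {u. if v < q * q
       then int q dvd int (snd (point u)) - int (v div q) * int (fst (point u)) - (int (v mod q) - (int (v div q))\<^sup>2)
       else fst (point u) = v - q * q}"

lemma point_less: "q > 0 \<Longrightarrow> fst (point v) < q" "q > 0 \<Longrightarrow> snd (point v) < q"
  by (auto simp: point_def less_mult_imp_div_less)

text \<open>The line of slope a through (a, b) has intercept b - a^2, so for each a every intercept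
  occurs and every non-vertical line is a block. Twins of the same point fall under the vertical
  case.\<close>

lemma exists_common_block:
  assumes q: "prime q" and n: "q * q + q \<le> n"
  shows "\<exists>z<n. u \<in> block z \<and> v \<in> block z"
proof (cases "fst (point u) = fst (point v)")
  case True
  have "fst (point u) < q" using point_less(1) prime_gt_0_nat[OF q] by simp
  then show ?thesis using True n by (intro exI[of _ "q * q + fst (point u)"]) (auto simp: block_def)
next
  case False
  have q0: "q > 0" using prime_gt_0_nat[OF q] .
  define x y x' y' where "x = int (fst (point u))" and "y = int (snd (point u))"
    and "x' = int (fst (point v))" and "y' = int (snd (point v))"
  have "\<not> int q dvd x - x'"
  proof
    assume "int q dvd x - x'"
    then have "x mod int q = x' mod int q" by (simp add: mod_eq_dvd_iff)
    then show False using False point_less(1)[OF q0] by (simp add: x_def x'_def)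
  qed
  then have "coprime (x - x') (int q)"
    using q by (simp add: prime_imp_coprime coprime_commute)
  then obtain i where i: "[(x - x') * i = 1] (mod int q)" using cong_solve_coprime_int by blast
  \<comment> \<open>\<open>i\<close> inverts x - x' modulo q, so \<open>a\<close> is the slope of
    the line through both points; \<open>b\<close> is then solved from y = a x + b - a^2.\<close>
  define a where "a = nat (((y - y') * i) mod int q)"
  define b where "b = nat ((y - int a * x + (int a)\<^sup>2) mod int q)"
  have ab: "a < q" "b < q" using q0 by (auto simp: a_def b_def nat_less_iff)
  have "int a = (y - y') * i mod int q" using q0 by (simp add: a_def)
  then have "int q dvd int a - (y - y') * i" by (simp only: dvd_mod_diff)
  then have "int q dvd (x - x') * (int a - (y - y') * i) + (y - y') * ((x - x') * i - 1)"
    using i by (intro dvd_add dvd_mult) (auto simp: cong_iff_dvd_diff)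
  then have 1: "int q dvd int a * (x - x') - (y - y')" by (simp add: algebra_simps)
  have "int b = (y - int a * x + (int a)\<^sup>2) mod int q" using q0 by (simp add: b_def)
  then have 2: "int q dvd int b - (y - int a * x + (int a)\<^sup>2)" by (simp only: dvd_mod_diff)
  then have "int q dvd - (int b - (y - int a * x + (int a)\<^sup>2))" by (simp only: dvd_minus_iff)
  then have u: "int q dvd y - int a * x - (int b - (int a)\<^sup>2)" by (simp add: algebra_simps)
  then have "int q dvd (y - int a * x - (int b - (int a)\<^sup>2)) + (int a * (x - x') - (y - y'))"
    using 1 by (rule dvd_add)
  then have v: "int q dvd y' - int a * x' - (int b - (int a)\<^sup>2)" by (simp add: algebra_simps)
  have "a * q + b < Suc a * q" using ab by simp
  also have "\<dots> \<le> q * q" using ab by (intro mult_le_mono1) simp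
  finally have "a * q + b < q * q" .
  moreover have "(a * q + b) div q = a" "(a * q + b) mod q = b" using ab by auto
  ultimately show ?thesis
    using u v n by (intro exI[of _ "a * q + b"]) (auto simp: block_def x_def y_def x'_def y'_def)
qed

text \<open>A line has q points in the plane. A further vertex q * q + e lies on the parabola
  \<open>e div q\<close> at abscissa \<open>e mod q\<close>, and each of the t parabolas adds at
  most two vertices.\<close>

lemma card_block_le:
  assumes q: "prime q" and n: "n \<le> q * q + t * q"
  shows "card (block v \<inter> {..<n}) \<le> q + 2 * t"
proof -
  have q0: "q > 0" using prime_gt_0_nat[OF q] .
  define E where "E = {e. q * q + e \<in> block v \<and> e < t * q}"
  have "block v \<inter> {..<n} \<subseteq> (block v \<inter> {..<q * q}) \<union> (\<lambda>e. q * q + e) ` E"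
  proof
    fix u assume u: "u \<in> block v \<inter> {..<n}"
    show "u \<in> (block v \<inter> {..<q * q}) \<union> (\<lambda>e. q * q + e) ` E"
    proof (cases "u < q * q")
      case False
      then have "u = q * q + (u - q * q)" "u - q * q \<in> E" using u n by (auto simp: E_def)
      then show ?thesis by blast
    qed (use u in auto)
  qed
  moreover have finE: "finite E" by (rule finite_subset[of _ "{..<t * q}"]) (auto simp: E_def)
  ultimately have "card (block v \<inter> {..<n}) \<le> card ((block v \<inter> {..<q * q}) \<union> (\<lambda>e. q * q + e) ` E)"
    by (intro card_mono) auto
  also have "\<dots> \<le> card (block v \<inter> {..<q * q}) + card ((\<lambda>e. q * q + e) ` E)" by (rule card_Un_le)
  also have "card ((\<lambda>e. q * q + e) ` E) \<le> card E" by (rule card_image_le[OF finE])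
  also have "card (block v \<inter> {..<q * q}) \<le> q"
  proof (cases "v < q * q")
    case True
    have "inj_on (\<lambda>u. u div q) (block v \<inter> {..<q * q})"
    proof (rule inj_onI)
      fix u w assume u: "u \<in> block v \<inter> {..<q * q}" and w: "w \<in> block v \<inter> {..<q * q}" and eq: "u div q = w div q"
      have "int q dvd (int (u mod q) - int (v div q) * int (u div q) - (int (v mod q) - (int (v div q))\<^sup>2)) -
        (int (w mod q) - int (v div q) * int (w div q) - (int (v mod q) - (int (v div q))\<^sup>2))"
        by (rule dvd_diff) (use u w True in \<open>auto simp: block_def point_def\<close>)
      then have "int q dvd int (u mod q) - int (w mod q)" using eq by simp
      then have "int (u mod q) mod int q = int (w mod q) mod int q" by (simp add: mod_eq_dvd_iff)
      then have "u mod q = w mod q" by (simp flip: of_nat_mod)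
      then show "u = w" using eq by (metis div_mult_mod_eq)
    qed
    then show ?thesis
      by (rule card_le_by_inj[where B = "{..<q}"]) (auto simp: less_mult_imp_div_less)
  next
    case False
    have "inj_on (\<lambda>u. u mod q) (block v \<inter> {..<q * q})"
      using False by (intro inj_onI) (auto simp: block_def point_def, metis div_mult_mod_eq)
    then show ?thesis
      by (rule card_le_by_inj[where B = "{..<q}"]) (use q0 in auto)
  qed
  also have "card E \<le> 2 * t"
  proof (cases "v < q * q")
    case True
    define F where "F = (\<lambda>j. {e \<in> E. e div q = j})"
    have "E \<subseteq> (\<Union>j<t. F j)" by (auto simp: E_def F_def less_mult_imp_div_less)
    then have "card E \<le> card (\<Union>j<t. F j)"
      using finE by (intro card_mono) (auto simp: F_def)
    also have "\<dots> \<le> (\<Sum>j<t. card (F j))" by (rule card_UN_le) simp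
    also have "\<dots> \<le> (\<Sum>j<t. 2)"
    proof (rule sum_mono)
      fix j
      \<comment> \<open>Substituting y = x^2 + j into the equation of the line leaves a monic
        quadratic in x.\<close>
      define a b where "a = int (v div q)" and "b = int (v mod q) - (int (v div q))\<^sup>2 - int j"
      show "card (F j) \<le> 2"
      proof (rule card_le_by_inj[where B = "{x. x < q \<and> int q dvd (int x)\<^sup>2 - a * int x - b}"])
        show "inj_on (\<lambda>e. e mod q) (F j)"
          by (intro inj_onI) (auto simp: F_def, metis div_mult_mod_eq)
        show "(\<lambda>e. e mod q) ` F j \<subseteq> {x. x < q \<and> int q dvd (int x)\<^sup>2 - a * int x - b}"
        proof clarify
          fix e assume e: "e \<in> F j"
          define x where "x = e mod q"
          have "int q dvd int ((x\<^sup>2 + j) mod q) - a * int x - (b + int j)"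
            using e True by (auto simp: F_def E_def block_def point_def x_def a_def b_def)
          moreover have "int q dvd int (x\<^sup>2 + j) - int ((x\<^sup>2 + j) mod q)"
            using dvd_mod_diff[of "int q" "int (x\<^sup>2 + j)"] by (subst dvd_diff_commute) (simp only: zmod_int)
          ultimately have "int q dvd (int ((x\<^sup>2 + j) mod q) - a * int x - (b + int j)) + (int (x\<^sup>2 + j) - int ((x\<^sup>2 + j) mod q))"
            by (rule dvd_add)
          also have "\<dots> = (int x)\<^sup>2 - a * int x - b" by simp
          finally show "e mod q < q \<and> int q dvd (int (e mod q))\<^sup>2 - a * int (e mod q) - b"
            using q0 by (simp add: x_def)
        qed
      qed (use card_quadratic_roots_le[OF q] in auto)
    qed
    finally show ?thesis by simp
  next
    case False
    \<comment> \<open>On a vertical line \<open>e mod q\<close> is fixed, so each parabola adds at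
      most one vertex.\<close>
    have "inj_on (\<lambda>e. e div q) E"
      using False by (intro inj_onI) (auto simp: E_def block_def point_def, metis div_mult_mod_eq)
    then have "card E \<le> t"
      by (rule card_le_by_inj[where B = "{..<t}"]) (auto simp: E_def less_mult_imp_div_less)
    then show ?thesis by simp
  qed
  finally show ?thesis by simp
qed

text \<open>The lower bound on n leaves room for the mediators of the q vertical lines; the last
  parabola may be only partly filled.\<close>

lemma mediation_number_le_prime:
  assumes q: "prime q" and n: "q * q + q \<le> n" "n \<le> q * q + t * q"
  shows "mediation_number n \<le> q + 2 * t"
proof -
  define D where "D = \<lparr> pverts = {..<n}, parcs = {(u, v). u < n \<and> v < n \<and> u \<in> block v \<and> u \<noteq> v} \<rparr>"
  have "finite (parcs D)"
    by (rule finite_subset[of _ "{..<n} \<times> {..<n}"]) (auto simp: D_def)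
  then have "pair_digraph D"
    by unfold_locales (auto simp: D_def)
  moreover have nb: "closed_in_nbhd D z = insert z (block z \<inter> {..<n})" if "z < n" for z
    using that by (auto simp: closed_in_nbhd_def in_nbhd_def D_def)
  have "\<exists>z\<in>pverts D. u \<in> closed_in_nbhd D z \<and> v \<in> closed_in_nbhd D z"
    if "u \<in> pverts D" "v \<in> pverts D" for u v
  proof -
    obtain z where "z < n" "u \<in> block z" "v \<in> block z" using exists_common_block[OF q n(1)] by blast
    then show ?thesis using that by (intro bexI[of _ z]) (auto simp: nb, auto simp: D_def)
  qed
  ultimately have "mediated D" by (simp add: mediated_def)
  from mediation_number_le[OF this] have "mediation_number n \<le> max_in_degree D"
    by (simp add: D_def)
  also have "max_in_degree D \<le> q + 2 * t"
  proof -
    have "card (in_nbhd D v) \<le> q + 2 * t" for v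
    proof -
      have "card (in_nbhd D v) \<le> card (block v \<inter> {..<n})"
        by (intro card_mono) (auto simp: in_nbhd_def D_def)
      then show ?thesis using card_block_le[OF q n(2), of v] by linarith
    qed
    moreover have "n > 0" using n prime_gt_0_nat[OF q] by (intro Nat.gr0I) auto
    ultimately show ?thesis
      unfolding max_in_degree_def by (intro Max.boundedI) (auto simp: D_def)
  qed
  finally show ?thesis .
qed

end

section \<open>Asymptotic conclusion\<close>

theorem primes_in_short_intervals:
  fixes \<epsilon> :: real
  assumes "\<epsilon> > 0"
  shows "\<forall>\<^sub>F m in sequentially. \<exists>p. prime p \<and> m < p \<and> real p \<le> (1 + \<epsilon>) * real m"
proof -
  have "\<forall>\<^sub>F m in sequentially. \<exists>p. prime p \<and> m < p \<and> real p \<le> (1 + min \<epsilon> 1) * real m"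
    using assms by (intro primes_in_short_intervals_if_summable summable_psi_error) auto
  then show ?thesis
  proof eventually_elim
    case (elim m)
    then obtain p where p: "prime p" "m < p" "real p \<le> (1 + min \<epsilon> 1) * real m" by blast
    have "(1 + min \<epsilon> 1) * real m \<le> (1 + \<epsilon>) * real m" by (intro mult_right_mono) auto
    then show ?case using p by (intro exI[of _ p]) auto
  qed
qed

lemma f_bound_ge:
  assumes "n \<ge> 1"
  shows "real_of_int (f_bound n) \<ge> sqrt (real n) - 1"
proof -
  have "(2 * sqrt (real n) - 1)\<^sup>2 = 4 * real n - 4 * sqrt (real n) + 1"
    by (simp add: power2_diff power_mult_distrib)
  also have "\<dots> \<le> 4 * real n - 3" using assms by simp
  finally have "2 * sqrt (real n) - 1 \<le> sqrt (4 * real n - 3)" by (rule real_le_rsqrt)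
  then have "sqrt (real n) - 1 \<le> (sqrt (4 * real n - 3) - 1) / 2" by simp
  also have "\<dots> \<le> real_of_int (f_bound n)"
    unfolding f_bound_def by (rule le_of_int_ceiling)
  finally show ?thesis .
qed

lemma mediation_number_le_sqrt:
  fixes \<epsilon> :: real
  assumes \<epsilon>: "\<epsilon> > 0"
  shows "\<forall>\<^sub>F n in sequentially. real (mediation_number n) \<le> (1 + \<epsilon>) * sqrt (real n)"
proof -
  \<comment> \<open>With s = \<open>sqrt n\<close>, the prime lies between (1 - 2 \<delta>) s and (1
    - \<delta>) s. At most 4 \<delta> n vertices remain, so t <= 8 \<delta> s + 1, using 1 - 2
    \<delta> >= 1/2. The degree is at most s + 16 \<delta> s + 2 <= s + 32 \<delta> s.\<close>
  define \<delta> where "\<delta> = min (\<epsilon> / 32) (1 / 4)"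
  have \<delta>: "0 < \<delta>" "\<delta> \<le> 1 / 4" "32 * \<delta> \<le> \<epsilon>" using \<epsilon> by (auto simp: \<delta>_def)
  define m where "m = (\<lambda>n :: nat. nat \<lfloor>(1 - 2 * \<delta>) * sqrt (real n)\<rfloor>)"
  have m: "real (m n) \<le> (1 - 2 * \<delta>) * sqrt (real n)" "(1 - 2 * \<delta>) * sqrt (real n) < real (m n) + 1" for n
  proof -
    have "0 \<le> (1 - 2 * \<delta>) * sqrt (real n)" using \<delta> by simp
    then show "real (m n) \<le> (1 - 2 * \<delta>) * sqrt (real n)" "(1 - 2 * \<delta>) * sqrt (real n) < real (m n) + 1"
      unfolding m_def by linarith+
  qed
  have "filterlim (\<lambda>n :: nat. (1 - 2 * \<delta>) * sqrt (real n) - 1) at_top sequentially"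
    using \<delta> by real_asymp
  then have "filterlim (\<lambda>n. real (m n)) at_top sequentially"
    by (rule filterlim_at_top_mono) (use m in \<open>auto simp: less_imp_le algebra_simps\<close>)
  then have "filterlim m at_top sequentially"
    unfolding filterlim_sequentially_iff_filterlim_real .
  from eventually_compose_filterlim[OF primes_in_short_intervals[OF \<delta>(1)] this]
  have "\<forall>\<^sub>F n in sequentially. \<exists>p. prime p \<and> m n < p \<and> real p \<le> (1 + \<delta>) * real (m n)" .
  moreover have "\<forall>\<^sub>F n in sequentially. 2 \<le> 16 * \<delta> * sqrt (real n)" using \<delta> by real_asymp
  moreover have "\<forall>\<^sub>F n in sequentially. 1 \<le> \<delta> * sqrt (real n)" using \<delta> by real_asymp
  ultimately show ?thesis
  proof eventually_elim
    case (elim n)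
    define s where "s = sqrt (real n)"
    have s2: "s * s = real n" by (simp add: s_def)
    have s1: "1 \<le> \<delta> * s" using elim by (simp add: s_def)
    have s0: "s > 0" using s1 \<delta>(1) by (smt (verit) mult_nonneg_nonpos)
    obtain q where q: "prime q" "m n < q" "real q \<le> (1 + \<delta>) * real (m n)" using elim by blast
    have q0: "q > 0" using prime_gt_0_nat[OF q(1)] .
    have "real (m n) + 1 \<le> real q" using q(2) by linarith
    then have qlo: "(1 - 2 * \<delta>) * s \<le> real q" using m(2)[of n] by (simp add: s_def)
    have "real q \<le> (1 + \<delta>) * ((1 - 2 * \<delta>) * s)"
      using q(3) m(1)[of n] \<delta> by (smt (verit) mult_left_mono s_def)
    also have "\<dots> = (1 - \<delta>) * s - 2 * \<delta> * \<delta> * s" by (simp add: algebra_simps)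
    also have "\<dots> \<le> (1 - \<delta>) * s" using s0 \<delta> by simp
    finally have qhi: "real q \<le> (1 - \<delta>) * s" .
    \<comment> \<open>Staying \<delta> s >= 1 below s gives room for the q vertical
      mediators.\<close>
    have "real (q * q + q) = real q * (real q + 1)" by (simp add: algebra_simps)
    also have "\<dots> \<le> ((1 - \<delta>) * s) * ((1 - \<delta>) * s + \<delta> * s)"
      using qhi s1 by (intro mult_mono add_mono) auto
    also have "\<dots> = (1 - \<delta>) * (s * s)" by (simp add: algebra_simps)
    also have "\<dots> \<le> real n" using s2 \<delta> by (simp add: mult_left_le_one_le)
    finally have qn: "q * q + q \<le> n" by (simp only: of_nat_le_iff)
    define t where "t = (n - q * q) div q + 1"
    have "n - q * q < t * q"
      unfolding t_def using q0 by (simp add: mult.commute dividend_less_times_div)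
    then have tn: "n \<le> q * q + t * q" by linarith
    have "real t \<le> 8 * \<delta> * s + 1"
    proof -
      have "real ((n - q * q) div q) \<le> real (n - q * q) / real q" by (rule of_nat_div_le_of_nat)
      also have "\<dots> \<le> 8 * \<delta> * s"
      proof -
        have "((1 - 2 * \<delta>) * s) * ((1 - 2 * \<delta>) * s) \<le> real q * real q"
          using qlo \<delta> s0 by (intro mult_mono) auto
        then have "real (n - q * q) \<le> s * s - ((1 - 2 * \<delta>) * s) * ((1 - 2 * \<delta>) * s)"
          using qn by (simp add: of_nat_diff s2)
        also have "\<dots> = (4 * \<delta> - 4 * \<delta> * \<delta>) * (s * s)" by (simp add: algebra_simps)
        also have "\<dots> \<le> (4 * \<delta>) * (s * s)" using \<delta> by (intro mult_right_mono) auto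
        also have "\<dots> \<le> (8 * \<delta> * (1 - 2 * \<delta>)) * (s * s)"
          using \<delta> by (intro mult_right_mono) (auto simp: algebra_simps)
        also have "\<dots> = 8 * \<delta> * s * ((1 - 2 * \<delta>) * s)" by (simp add: algebra_simps)
        also have "\<dots> \<le> 8 * \<delta> * s * real q" using qlo \<delta> s0 by (intro mult_left_mono) auto
        finally show ?thesis using q0 by (simp add: divide_le_eq)
      qed
      finally show ?thesis by (simp add: t_def)
    qed
    moreover have "real (mediation_number n) \<le> real (q + 2 * t)"
      using mediation_number_le_prime[OF q(1) qn tn] by (rule of_nat_mono)
    moreover have "(1 - \<delta>) * s \<le> 1 * s" using s0 \<delta> by (intro mult_right_mono) auto
    then have "real q \<le> s" using qhi by linarith
    ultimately have "real (mediation_number n) \<le> s + 2 * (8 * \<delta> * s + 1)" by simp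
    also have "\<dots> \<le> s + 32 * \<delta> * s" using elim by (simp add: s_def)
    also have "\<dots> \<le> (1 + \<epsilon>) * s" using \<delta>(3) s0 by (simp add: algebra_simps)
    finally show ?case by (simp add: s_def)
  qed
qed

theorem theorem5p4:
  shows "\<exists>\<epsilon> :: nat \<Rightarrow> real. \<epsilon> \<in> o(\<lambda>_. 1) \<and>
    (\<forall>n \<ge> 1. real (mediation_number n) = real_of_int (f_bound n) * (1 + \<epsilon> n))"
proof -
  define \<epsilon> where "\<epsilon> = (\<lambda>n. real (mediation_number n) / real_of_int (f_bound n) - 1)"
  have "\<epsilon> \<in> o(\<lambda>_. 1)"
  proof (rule landau_o.smallI)
    fix c :: real assume c: "c > 0"
    have "\<forall>\<^sub>F n in sequentially. real (mediation_number n) \<le> (1 + c / 2) * sqrt (real n)"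
      using c by (intro mediation_number_le_sqrt) simp
    \<comment> \<open>The slack between c / 2 and c absorbs the -1 in
      \<open>f_bound_ge\<close>.\<close>
    moreover have "\<forall>\<^sub>F n :: nat in sequentially. (1 + c / 2) * sqrt (real n) \<le> (1 + c) * (sqrt (real n) - 1)"
      using c by real_asymp
    moreover have "\<forall>\<^sub>F n :: nat in sequentially. 0 < sqrt (real n) - 1" by real_asymp
    ultimately show "\<forall>\<^sub>F n in sequentially. norm (\<epsilon> n) \<le> c * norm (1 :: real)"
      using eventually_ge_at_top[of 1]
    proof eventually_elim
      case (elim n)
      have f: "sqrt (real n) - 1 \<le> real_of_int (f_bound n)" using f_bound_ge elim by blast
      then have f0: "real_of_int (f_bound n) > 0" using elim by linarith
      have "real_of_int (f_bound n) \<le> real (mediation_number n)"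
        using f_bound_le_mediation_number[of n] elim by linarith
      then have "\<epsilon> n \<ge> 0" using f0 by (simp add: \<epsilon>_def)
      moreover have "real (mediation_number n) \<le> (1 + c) * real_of_int (f_bound n)"
        using elim mult_left_mono[OF f, of "1 + c"] c by linarith
      then have "\<epsilon> n \<le> c" using f0 by (simp add: \<epsilon>_def field_simps)
      ultimately show ?case by simp
    qed
  qed
  moreover have "real (mediation_number n) = real_of_int (f_bound n) * (1 + \<epsilon> n)" if "n \<ge> 1" for n
  \<comment> \<open>At n = 1 the quotient defining \<open>\<epsilon>\<close> is 0 / 0, and the
    equation holds because both sides vanish.\<close>
  proof (cases "n = 1")
    case True
    have "f_bound 1 = 0" by (simp add: f_bound_def)
    then show ?thesis using True mediation_number_one by simp
  next
    case False
    then have "sqrt (4 * real n - 3) > 1" using that by simp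
    then have "f_bound n > 0" unfolding f_bound_def by simp
    then show ?thesis by (simp add: \<epsilon>_def)
  qed
  ultimately show ?thesis by blast
qed

end
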